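(* Let $\{X^k\}$ be generated by the EIRNRI algorithm described in the context, and let $\chi^\infty$ be the set of cluster points of $\{X^k\}$. Then: (i) $\chi^\infty$ is a nonempty, compact and connected set. (ii) $\{F(X^k)\}$ is convergent. Moreover, $F$ is constant on $\chi^\infty$. (iii) $\lim_{k\to\infty}\|E^{k+1}\|_F=0$, where $$E^{k+1}=\nabla f(X^{k+1})+\lambda U^{k+1}\mathrm{diag}(\bar{\bm w}^{k+1}\circ\bm\xi^{k+1})(V^{k+1})^\top$$ with $\bar w_i^{k+1}=p\,\sigma_i(X^{k+1})^{p-1}$ for $i\in\mathcal I(X^{k+1})$, $\bar w_i^{k+1}=w_i^k$ for $i\in\mathcal Z(X^{k+1})$. Therefore every cluster point $X^*\in\chi^\infty$ is a critical point of $F$, i.e. $\bm 0\in\partial F(X^* )$.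
   Context: Problem and assumptions. $m\le n$, $p\in(0,1)$, $\lambda>0$; $\sigma_1(X)\ge\dots\ge\sigma_m(X)\ge0$ are the singular values of $X\in\mathbb{R}^{m\times n}$; $F(X)=f(X)+\lambda\sum_{i=1}^m\sigma_i(X)^p$, where $f:\mathbb{R}^{m\times n}\to\mathbb{R}$ is twice continuously differentiable and $\|\nabla f(X)-\nabla f(Y)\|_F\le L_f\|X-Y\|_F$ for all $X,Y$ ($L_f\ge0$). $F$ is level-bounded, i.e. $F(X)\to+\infty$ as $\|X\|\to\infty$ (so $F$ is bounded below and has a minimizer). $[m]=\{1,\dots,m\}$; $\mathcal I(X)=\{i\in[m]:\sigma_i(X)>0\}$, $\mathcal Z(X)=\{i\in[m]:\sigma_i(X)=0\}$; $\circ$ is the entrywise product. Limiting subdifferential: $\widehat\partial F(X)$ is the set of $V$ with $\liminf_{Z\to X,Z\neq X}\frac{F(Z)-F(X)-\langle V,Z-X\rangle}{\|Z-X\|_F}\ge0$, and $\partial F(X)$ is the set of limits of $V^j\in\widehat\partial F(X^j)$ with $X^j\to X$, $F(X^j)\to F(X)$. EIRNRI algorithm. Fix $\beta>L_f$, $\mu\in(0,1)$, $X^{-1}=X^0\in\mathbb{R}^{m\times n}$, $\bm\epsilon^0\in\mathbb{R}^m$ with positive, non-increasing entries, and $\bar\alpha$ with $\bar\alpha\in(0,1)$ if $f$ is convex, and $\bar\alpha\in\big(0,\sqrt{\beta/(\beta+3L_f)}\big)$ otherwise. For $k=0,1,2,\dots$: choose $\alpha_k\in[0,\bar\alpha]$;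 set $w_i^k=p(\sigma_i(X^k)+\epsilon_i^k)^{p-1}$, $i\in[m]$; set $Y^k=X^k+\alpha_k(X^k-X^{k-1})$; let $U^{k+1}\mathrm{diag}(\Sigma^{k+1})(V^{k+1})^\top$ be a singular value decomposition (singular values in non-increasing order) of $\frac{X^k+Y^k}{2}-\frac{\nabla f(Y^k)}{2\beta}$ and set $X^{k+1}=U^{k+1}\mathrm{diag}\big(\big[\Sigma_i^{k+1}-\frac{\lambda w_i^k}{2\beta}\big]_+\big)(V^{k+1})^\top$, which is a global minimizer of $X\mapsto f(Y^k)+\langle X,\nabla f(Y^k)\rangle+\frac\beta2\|X-Y^k\|_F^2+\frac\beta2\|X-X^k\|_F^2+\lambda\sum_{i}w_i^k\sigma_i(X)$; then update $\bm\epsilon^k$ to $\bm\epsilon^{k+1}$ as below. The vector $\bm\xi^{k+1}\in\mathbb{R}^m$ is the one with $\xi_i^{k+1}=1$ for $i\in\mathcal I(X^{k+1})$, $\xi_i^{k+1}\in[-1,1]$ for $i\in\mathcal Z(X^{k+1})$, satisfying the subproblem optimality condition $$\bm0=\nabla f(Y^k)+\beta(X^{k+1}-Y^k)+\beta(X^{k+1}-X^k)+\lambda U^{k+1}\mathrm{diag}(\bm w^k\circ\bm\xi^{k+1})(V^{k+1})^\top .$$ Update of $\bm\epsilon$. Write $r=|\mathcal I(X^k)|$, $r^+=|\mathcal I(X^{k+1})|$. Case $\mathcal I(X^{k+1})\subsetneq\mathcal I(X^k)$: $\epsilon_i^{k+1}=\mu\epsilon_i^k$ for $i\in\mathcal I(X^{k+1})$;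 put $\tau_1=\sigma_{r^+}(X^{k+1})+\epsilon_{r^+}^{k+1}$, $\tau_2=\epsilon_{r^++1}^k$; for $i\in\mathcal I(X^k)\setminus\mathcal I(X^{k+1})$ set $\epsilon_i^{k+1}=\epsilon_i^k$ if $\tau_1\ge\tau_2$, and $\epsilon_i^{k+1}=\min(\epsilon_i^k,\mu\tau_1)$ otherwise; put $\tau_3=\epsilon_r^{k+1}$ and set $\epsilon_i^{k+1}=\min\{\epsilon_i^k,\tau_3\}$ for $i\in\mathcal Z(X^k)$. Case $\mathcal I(X^k)\subsetneq\mathcal I(X^{k+1})$: $\epsilon_i^{k+1}=\mu\epsilon_i^k$ for $i\in\mathcal I(X^k)$; put $\tau_3=\epsilon_r^k$ and set $\epsilon_i^{k+1}=\mu\min\{\epsilon_i^k,\tau_3\}$ for $i\in\mathcal I(X^{k+1})\setminus\mathcal I(X^k)$; put $\tau_1=\sigma_{r^+}(X^{k+1})+\epsilon_{r^+}^{k+1}$, $\tau_2=\epsilon^k_{r^++1}$; for $i\in\mathcal Z(X^{k+1})$ set $\epsilon_i^{k+1}=\epsilon_i^k$ if $\tau_1\ge\tau_2$, and $\min(\epsilon_i^k,\mu\tau_1)$ otherwise. Case $\mathcal I(X^k)=\mathcal I(X^{k+1})$: $\epsilon_i^{k+1}=\mu\epsilon_i^k$ for $i\in\mathcal I(X^{k+1})$; put $\tau_1=\sigma_{r^+}(X^{k+1})+\epsilon_{r^+}^{k+1}$, $\tau_2=\epsilon^k_{r^++1}$; for $i\in\mathcal Z(X^{k+1})$ set $\epsilon_i^{k+1}=\epsilon_i^k$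 if $\tau_1\ge\tau_2$, and $\min(\epsilon_i^k,\mu\tau_1)$ otherwise. Convention: a threshold $\tau_1$ or $\tau_3$ whose defining index is $0$ is $+\infty$. *)

theory Defs
  imports "HOL-Analysis.Analysis"
begin

text \<open>
  \<open>('m, 'n) rmat\<close> is the library's type of matrices with row indices \<open>'m\<close> and column indices \<open>'n\<close>,
  usually written with the row index last. The index type \<open>'m\<close> of the shorter side is linearly
  ordered and plays the role of \<open>{1, ..., m}\<close>, so vectors that are listed in a specific order (singular
  values, weights, smoothing parameters) have type \<open>'m rvec\<close>. On these types the library's
  \<open>norm\<close> is the Frobenius norm and \<open>inner\<close> the trace inner product, and \<open>*\<close> on \<open>'m rvec\<close> is the
  entrywise product.
\<close>

type_synonym 'm rvec = "(real, 'm) vec"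
type_synonym ('m, 'n) rmat = "((real, 'n) vec, 'm) vec"

section \<open>Singular values\<close>

definition diag :: "'m::finite rvec \<Rightarrow> ('m, 'm) rmat" where
  "diag s = (\<chi> i j. if i = j then s $ i else 0)"

text \<open>Thin singular value decomposition (for m at most n): \<open>V\<close> is n-by-m with orthonormal columns.\<close>

definition is_svd ::
    "('m::{finite,linorder}, 'n::finite) rmat \<Rightarrow> ('m, 'm) rmat \<Rightarrow> 'm rvec \<Rightarrow> ('n, 'm) rmat \<Rightarrow> bool" where
  "is_svd A U s V \<longleftrightarrow>
     orthogonal_matrix U \<and> transpose V ** V = mat 1 \<and>
     (\<forall>i. 0 \<le> s $ i) \<and> antimono (($) s) \<and>
     A = U ** diag s ** transpose V"

definition singular_values :: "('m::{finite,linorder}, 'n::finite) rmat \<Rightarrow> 'm rvec" where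
  "singular_values A = (THE s. \<exists>U V. is_svd A U s V)"

definition pos_idx :: "('m::{finite,linorder}, 'n::finite) rmat \<Rightarrow> 'm set" where
  "pos_idx A = {i. singular_values A $ i > 0}"

definition zero_idx :: "('m::{finite,linorder}, 'n::finite) rmat \<Rightarrow> 'm set" where
  "zero_idx A = {i. singular_values A $ i = 0}"

text \<open>Entry number \<open>j\<close>, counted from 1, of a vector; only meaningful for \<open>1 \<le> j \<le> m\<close>.\<close>

definition entry :: "'m::{finite,linorder} rvec \<Rightarrow> nat \<Rightarrow> real" where
  "entry x j = x $ (THE i. card {..i} = j)"

definition objective ::
    "(('m::{finite,linorder}, 'n::finite) rmat \<Rightarrow> real) \<Rightarrow> real \<Rightarrow> real \<Rightarrow> ('m, 'n) rmat \<Rightarrow> real" where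
  "objective f lam p X = f X + lam * (\<Sum>i\<in>UNIV. singular_values X $ i powr p)"

section \<open>Subdifferentials and cluster points\<close>

definition frechet_subdifferential :: "('a::real_inner \<Rightarrow> real) \<Rightarrow> 'a \<Rightarrow> 'a set" where
  "frechet_subdifferential F X =
     {V. Liminf (at X) (\<lambda>Z. ereal ((F Z - F X - V \<bullet> (Z - X)) / norm (Z - X))) \<ge> 0}"

definition limiting_subdifferential :: "('a::real_inner \<Rightarrow> real) \<Rightarrow> 'a \<Rightarrow> 'a set" where
  "limiting_subdifferential F X =
     {V. \<exists>Xs Vs. Xs \<longlonglongrightarrow> X \<and> (\<lambda>j. F (Xs j)) \<longlonglongrightarrow> F X \<and>
           (\<forall>j. Vs j \<in> frechet_subdifferential F (Xs j)) \<and> Vs \<longlonglongrightarrow> V}"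

definition cluster_points :: "(nat \<Rightarrow> 'a::topological_space) \<Rightarrow> 'a set" where
  "cluster_points X = {L. \<exists>r. strict_mono r \<and> (X \<circ> r) \<longlonglongrightarrow> L}"

section \<open>The EIRNRI algorithm\<close>

definition weights ::
    "real \<Rightarrow> ('m::{finite,linorder}, 'n::finite) rmat \<Rightarrow> 'm rvec \<Rightarrow> 'm rvec" where
  "weights p X e = (\<chi> i. p * (singular_values X $ i + e $ i) powr (p - 1))"

text \<open>
  In the three definitions below, \<open>X, e\<close> are the current iterate and smoothing vector, \<open>X', e'\<close> the
  next ones. The thresholds are extended reals, as they are infinite if their defining index is 0.
  If \<open>X'\<close> has full rank, \<open>\<tau>\<^sub>2\<close> is a junk value, but then no index is subject to the rule using it.
\<close>

definition tau1 :: "('m::{finite,linorder}, 'n::finite) rmat \<Rightarrow> 'm rvec \<Rightarrow> ereal" where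
  "tau1 X' e' =
     (let r' = card (pos_idx X') in
      if r' = 0 then \<infinity> else ereal (entry (singular_values X') r' + entry e' r'))"

definition threshold_rule ::
    "real \<Rightarrow> ('m::{finite,linorder}, 'n::finite) rmat \<Rightarrow> 'm rvec \<Rightarrow> 'm rvec \<Rightarrow> 'm \<Rightarrow> bool" where
  "threshold_rule mu X' e e' i \<longleftrightarrow>
     (let \<tau>\<^sub>1 = tau1 X' e'; \<tau>\<^sub>2 = ereal (entry e (card (pos_idx X') + 1)) in
      ereal (e' $ i) = (if \<tau>\<^sub>1 \<ge> \<tau>\<^sub>2 then ereal (e $ i) else min (ereal (e $ i)) (ereal mu * \<tau>\<^sub>1)))"

definition eps_update ::
    "real \<Rightarrow> ('m::{finite,linorder}, 'n::finite) rmat \<Rightarrow> ('m, 'n) rmat \<Rightarrow> 'm rvec \<Rightarrow> 'm rvec \<Rightarrow> bool" where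
  "eps_update mu X X' e e' \<longleftrightarrow>
     (let r = card (pos_idx X) in
      (pos_idx X' \<subset> pos_idx X \<longrightarrow>
         (let \<tau>\<^sub>3 = (if r = 0 then \<infinity> else ereal (entry e' r)) in
          (\<forall>i\<in>pos_idx X'. e' $ i = mu * e $ i) \<and>
          (\<forall>i\<in>pos_idx X - pos_idx X'. threshold_rule mu X' e e' i) \<and>
          (\<forall>i\<in>zero_idx X. ereal (e' $ i) = min (ereal (e $ i)) \<tau>\<^sub>3))) \<and>
      (pos_idx X \<subset> pos_idx X' \<longrightarrow>
         (let \<tau>\<^sub>3 = (if r = 0 then \<infinity> else ereal (entry e r)) in
          (\<forall>i\<in>pos_idx X. e' $ i = mu * e $ i) \<and>
          (\<forall>i\<in>pos_idx X' - pos_idx X. ereal (e' $ i) = ereal mu * min (ereal (e $ i)) \<tau>\<^sub>3) \<and>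
          (\<forall>i\<in>zero_idx X'. threshold_rule mu X' e e' i))) \<and>
      (pos_idx X = pos_idx X' \<longrightarrow>
         (\<forall>i\<in>pos_idx X'. e' $ i = mu * e $ i) \<and>
         (\<forall>i\<in>zero_idx X'. threshold_rule mu X' e e' i)))"

text \<open>
  Since \<open>0 - 1 = 0\<close> on natural numbers, \<open>X (k - 1)\<close> for \<open>k = 0\<close> is \<open>X 0\<close>, as required by the
  initialisation \<open>X\<^sup>-\<^sup>1 = X\<^sup>0\<close>.
\<close>

definition extrapolated :: "(nat \<Rightarrow> real) \<Rightarrow> (nat \<Rightarrow> 'a::real_vector) \<Rightarrow> nat \<Rightarrow> 'a" where
  "extrapolated alpha X k = X k + alpha k *\<^sub>R (X k - X (k - 1))"

text \<open>
  \<open>gradf\<close> is the gradient of \<open>f\<close> and \<open>L\<close> its Lipschitz constant. The values \<open>U 0\<close>, \<open>S 0\<close>, \<open>V 0\<close> are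
  unused.
\<close>

definition EIRNRI ::
    "(('m::{finite,linorder}, 'n::finite) rmat \<Rightarrow> real) \<Rightarrow> (('m, 'n) rmat \<Rightarrow> ('m, 'n) rmat) \<Rightarrow> real \<Rightarrow> real \<Rightarrow> real \<Rightarrow>
     real \<Rightarrow> real \<Rightarrow> real \<Rightarrow> (nat \<Rightarrow> real) \<Rightarrow> (nat \<Rightarrow> ('m, 'n) rmat) \<Rightarrow> (nat \<Rightarrow> 'm rvec) \<Rightarrow>
     (nat \<Rightarrow> ('m, 'm) rmat) \<Rightarrow> (nat \<Rightarrow> 'm rvec) \<Rightarrow> (nat \<Rightarrow> ('n, 'm) rmat) \<Rightarrow> bool" where
  "EIRNRI f gradf L lam p beta mu alpha_bar alpha X eps U S V \<longleftrightarrow>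
     beta > L \<and> 0 < mu \<and> mu < 1 \<and>
     (\<forall>i. eps 0 $ i > 0) \<and> antimono (($) (eps 0)) \<and>
     0 < alpha_bar \<and>
     (if convex_on UNIV f then alpha_bar < 1 else alpha_bar < sqrt (beta / (beta + 3 * L))) \<and>
     (\<forall>k. 0 \<le> alpha k \<and> alpha k \<le> alpha_bar) \<and>
     (\<forall>k. let Y = extrapolated alpha X k; w = weights p (X k) (eps k) in
        is_svd ((1 / 2) *\<^sub>R (X k + Y) - (1 / (2 * beta)) *\<^sub>R gradf Y)
               (U (Suc k)) (S (Suc k)) (V (Suc k)) \<and>
        X (Suc k) =
          U (Suc k) ** diag (\<chi> i. max 0 (S (Suc k) $ i - lam * w $ i / (2 * beta)))
            ** transpose (V (Suc k)) \<and>
        eps_update mu (X k) (X (Suc k)) (eps k) (eps (Suc k)))"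

text \<open>
  The vector \<open>\<xi>\<close> attached to a step from \<open>X\<close> to \<open>X'\<close> with extrapolated point \<open>Y\<close>, weights \<open>w\<close>
  and singular vectors \<open>U, V\<close>. It exists and is unique along the algorithm, because \<open>w\<close> is positive
  and the columns of \<open>U\<close> and \<open>V\<close> are orthonormal.
\<close>

definition xi_vector ::
    "(('m::{finite,linorder}, 'n::finite) rmat \<Rightarrow> ('m, 'n) rmat) \<Rightarrow> real \<Rightarrow> real \<Rightarrow> ('m, 'n) rmat \<Rightarrow> ('m, 'n) rmat \<Rightarrow>
     ('m, 'n) rmat \<Rightarrow> 'm rvec \<Rightarrow> ('m, 'm) rmat \<Rightarrow> ('n, 'm) rmat \<Rightarrow> 'm rvec" where
  "xi_vector gradf lam beta X Y X' w U V =
     (THE \<xi>. (\<forall>i\<in>pos_idx X'. \<xi> $ i = 1) \<and> (\<forall>i\<in>zero_idx X'. -1 \<le> \<xi> $ i \<and> \<xi> $ i \<le> 1) \<and>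
        0 = gradf Y + beta *\<^sub>R (X' - Y) + beta *\<^sub>R (X' - X)
              + lam *\<^sub>R (U ** diag (w * \<xi>) ** transpose V))"

definition limit_weights ::
    "real \<Rightarrow> ('m::{finite,linorder}, 'n::finite) rmat \<Rightarrow> 'm rvec \<Rightarrow> 'm rvec" where
  "limit_weights p X' w =
     (\<chi> i. if i \<in> pos_idx X' then p * singular_values X' $ i powr (p - 1) else w $ i)"

text \<open>\<open>residual ... k\<close> is the matrix \<open>E\<close> of iteration \<open>k + 1\<close>.\<close>

definition residual ::
    "(('m::{finite,linorder}, 'n::finite) rmat \<Rightarrow> ('m, 'n) rmat) \<Rightarrow> real \<Rightarrow> real \<Rightarrow> real \<Rightarrow> (nat \<Rightarrow> real) \<Rightarrow>
     (nat \<Rightarrow> ('m, 'n) rmat) \<Rightarrow> (nat \<Rightarrow> 'm rvec) \<Rightarrow> (nat \<Rightarrow> ('m, 'm) rmat) \<Rightarrow> (nat \<Rightarrow> ('n, 'm) rmat) \<Rightarrow>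
     nat \<Rightarrow> ('m, 'n) rmat" where
  "residual gradf lam p beta alpha X eps U V k =
     (let w = weights p (X k) (eps k);
          \<xi> = xi_vector gradf lam beta (X k) (extrapolated alpha X k) (X (Suc k)) w
                (U (Suc k)) (V (Suc k))
      in gradf (X (Suc k)) +
         lam *\<^sub>R (U (Suc k) ** diag (limit_weights p (X (Suc k)) w * \<xi>) ** transpose (V (Suc k))))"

end

theory Submission
  imports Defs
begin

text \<open>
  The matrix analysis rests on one inequality, \<open>von_neumann_trace\<close>: the inner product of two matrices is
  at most the inner product of their sorted spectra. It gives Mirsky's inequality \<open>svd_norm_diff_le\<close>, hence
  uniqueness and continuity of singular values. It shows that soft thresholding with increasing
  weights solves the nonconvex subproblem globally (\<open>soft_threshold_minimizes\<close>). Applied to a slightly perturbed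
  spectrum, it also yields the Frechet subgradients of the objective
  (\<open>frechet_subdifferential_objective\<close>): on the positive singular values the coefficient must be the
  derivative of the power, on the zero singular values it is free.

  The update of the smoothing parameters preserves the order of the smoothed singular values
  (\<open>eps_update_invariant\<close>). Therefore the weights are increasing and every iterate is a global solution of its
  subproblem. Comparing it with the previous iterate, and using concavity of the power and the Lipschitz bound
  for the gradient, one finds that \<open>f\<close> plus the smoothed powers plus \<open>beta / 2\<close> times the squared last step
  decreases by a fixed multiple of the squared step (\<open>merit_decrease_steps\<close>). Level-boundedness makes the
  iterates bounded and this merit function convergent, so the steps tend to 0. A bounded sequence with vanishing
  steps has a nonempty, compact and connected set of cluster points.

  For each index there is a dichotomy (\<open>eps_vanishes_or_index_dies\<close>): either its smoothing parameter tends to 0,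
  or its singular value is eventually 0. In both cases the difference between smoothed and unsmoothed powers
  converges, so the objective values converge with the merit, and continuity makes the objective constant on the
  cluster points.

  The residual differs from the exact first order condition of the subproblem by terms of the size of the steps and by
  the change of the weights on the positive indices. The threshold keeps surviving singular values away
  from 0 (\<open>surviving_value_bounded_below\<close>), where the weights are Lipschitz, so the change of the weights vanishes
  too. Finally, each residual is a Frechet subgradient at its iterate, and its convergence to 0 is the criticality of all
  cluster points.
\<close>

section \<open>The von Neumann trace inequality\<close>
text \<open>
  Layer cake: a nonnegative decreasing vector is a nonnegative combination of indicators of initial
  segments. This reduces the rearrangement inequality below to counting entries in a corner block.
\<close>
lemma antimono_step_decomposition:
  fixes c :: "'m::{finite,linorder} \<Rightarrow> real"
  assumes "antimono c" "\<And>i. 0 \<le> c i"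
  shows "\<exists>g. (\<forall>k. 0 \<le> g k) \<and> (\<forall>i. c i = (\<Sum>k\<in>UNIV. g k * (if i \<le> k then 1 else 0)))"
  using assms
proof (induction "card {i. 0 < c i}" arbitrary: c rule: less_induct)
  case less
  show ?case
  proof (cases "{i. 0 < c i} = {}")
    case True
    then have "c i = 0" for i using less.prems(2)[of i] by (auto simp: less_le)
    then show ?thesis by (intro exI[of _ "\<lambda>_. 0"]) auto
  next
    case False
    \<comment> \<open>Peel off the widest layer, the indicator of the support, with height the smallest positive value.\<close>
    define k where "k = Max {i. 0 < c i}"
    have k: "0 < c k" "\<And>i. 0 < c i \<Longrightarrow> i \<le> k"
      using False Max_in[of "{i. 0 < c i}"] by (auto simp: k_def)
    define c' where "c' i = c i - (if i \<le> k then c k else 0)" for i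
    have above: "c i = 0" if "\<not> i \<le> k" for i
      using k(2)[of i] less.prems(2)[of i] that by (auto simp: less_le)
    have c'k: "c' i = 0" if "k \<le> i" for i
      using above[of i] that by (cases "i = k") (auto simp: c'_def)
    have c'_nonneg: "0 \<le> c' i" for i
      using less.prems antimonoD[OF less.prems(1), of i k] above[of i] by (auto simp: c'_def)
    have c'_anti: "antimono c'"
    proof (rule antimonoI)
      fix i j :: 'm assume "i \<le> j"
      show "c' j \<le> c' i"
      proof (cases "j \<le> k")
        case True
        then show ?thesis using \<open>i \<le> j\<close> antimonoD[OF less.prems(1) \<open>i \<le> j\<close>] by (auto simp: c'_def)
      next
        case False
        then show ?thesis using c'k[of j] c'_nonneg[of i] by auto
      qed
    qed
    have "{i. 0 < c' i} \<subset> {i. 0 < c i}"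
    proof
      show "{i. 0 < c' i} \<subseteq> {i. 0 < c i}"
        using k(1) by (auto simp: c'_def split: if_splits)
      show "{i. 0 < c' i} \<noteq> {i. 0 < c i}"
        using k(1) c'k[of k] by (metis less_irrefl mem_Collect_eq order_refl)
    qed
    then have "card {i. 0 < c' i} < card {i. 0 < c i}"
      by (intro psubset_card_mono) auto
    from less.hyps[OF this c'_anti c'_nonneg] obtain g where
      g: "\<And>k. 0 \<le> g k" "\<And>i. c' i = (\<Sum>k\<in>UNIV. g k * (if i \<le> k then 1 else 0))"
      by blast
    have "c i = (\<Sum>l\<in>UNIV. (g l + (if l = k then c k else 0)) * (if i \<le> l then 1 else 0))" for i
    proof -
      have "(\<Sum>l\<in>UNIV. (g l + (if l = k then c k else 0)) * (if i \<le> l then 1 else 0))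
          = (\<Sum>l\<in>UNIV. g l * (if i \<le> l then 1 else 0)) +
            (\<Sum>l\<in>UNIV. if l = k then (if i \<le> k then c k else 0) else 0)"
        unfolding sum.distrib[symmetric] by (intro sum.cong) (auto simp: algebra_simps)
      also have "\<dots> = c' i + (if i \<le> k then c k else 0)"
        using g(2)[of i] by simp
      finally show ?thesis by (simp add: c'_def)
    qed
    moreover have "0 \<le> g l + (if l = k then c k else 0)" for l
      using g(1)[of l] k(1) by auto
    ultimately show ?thesis
      by (intro exI[of _ "\<lambda>l. g l + (if l = k then c k else 0)"]) blast
  qed
qed

text \<open>
  After both vectors are split into steps, the claim becomes that the top left \<open>k\<close>-by-\<open>l\<close> block of a
  doubly substochastic matrix has mass at most \<open>min k l\<close>, which is what the identity matrix attains.
\<close>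
lemma substochastic_rearrangement:
  fixes c s :: "'m::{finite,linorder} \<Rightarrow> real" and M :: "'m \<Rightarrow> 'm \<Rightarrow> real"
  assumes c: "antimono c" "\<And>i. 0 \<le> c i" and s: "antimono s" "\<And>i. 0 \<le> s i"
    and M: "\<And>i j. 0 \<le> M i j" "\<And>i. (\<Sum>j\<in>UNIV. M i j) \<le> 1" "\<And>j. (\<Sum>i\<in>UNIV. M i j) \<le> 1"
  shows "(\<Sum>i\<in>UNIV. \<Sum>j\<in>UNIV. c i * s j * M i j) \<le> (\<Sum>i\<in>UNIV. c i * s i)"
proof -
  let ?I = "\<lambda>(i::'m) k. if i \<le> k then 1 else (0::real)"
  obtain g where g: "\<And>k. 0 \<le> g k" "\<And>i. c i = (\<Sum>k\<in>UNIV. g k * ?I i k)"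
    using antimono_step_decomposition[OF c] by blast
  obtain h where h: "\<And>k. 0 \<le> h k" "\<And>i. s i = (\<Sum>k\<in>UNIV. h k * ?I i k)"
    using antimono_step_decomposition[OF s] by blast
  have expand: "(\<Sum>i\<in>UNIV. \<Sum>j\<in>UNIV. c i * s j * N i j)
      = (\<Sum>k\<in>UNIV. \<Sum>l\<in>UNIV. g k * h l * (\<Sum>i\<in>UNIV. \<Sum>j\<in>UNIV. ?I i k * ?I j l * N i j))"
    for N :: "'m \<Rightarrow> 'm \<Rightarrow> real"
  proof -
    have "(\<Sum>i\<in>UNIV. \<Sum>j\<in>UNIV. c i * s j * N i j)
        = (\<Sum>i\<in>UNIV. \<Sum>j\<in>UNIV. \<Sum>k\<in>UNIV. \<Sum>l\<in>UNIV. g k * h l * (?I i k * ?I j l * N i j))"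
    proof (intro sum.cong refl)
      fix i j
      have "c i * s j * N i j = (\<Sum>k\<in>UNIV. \<Sum>l\<in>UNIV. (g k * ?I i k) * (h l * ?I j l)) * N i j"
        by (simp only: g(2)[of i] h(2)[of j] sum_product)
      also have "\<dots> = (\<Sum>k\<in>UNIV. \<Sum>l\<in>UNIV. g k * h l * (?I i k * ?I j l * N i j))"
        unfolding sum_distrib_right by (intro sum.cong refl) (simp only: mult_ac)
      finally show "c i * s j * N i j
        = (\<Sum>k\<in>UNIV. \<Sum>l\<in>UNIV. g k * h l * (?I i k * ?I j l * N i j))" .
    qed
    also have "\<dots> = (\<Sum>i\<in>UNIV. \<Sum>k\<in>UNIV. \<Sum>j\<in>UNIV. \<Sum>l\<in>UNIV. g k * h l * (?I i k * ?I j l * N i j))"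
      by (rule sum.cong[OF refl], rule sum.swap)
    also have "\<dots> = (\<Sum>k\<in>UNIV. \<Sum>i\<in>UNIV. \<Sum>j\<in>UNIV. \<Sum>l\<in>UNIV. g k * h l * (?I i k * ?I j l * N i j))"
      by (rule sum.swap)
    also have "\<dots> = (\<Sum>k\<in>UNIV. \<Sum>i\<in>UNIV. \<Sum>l\<in>UNIV. \<Sum>j\<in>UNIV. g k * h l * (?I i k * ?I j l * N i j))"
      by (rule sum.cong[OF refl], rule sum.cong[OF refl], rule sum.swap)
    also have "\<dots> = (\<Sum>k\<in>UNIV. \<Sum>l\<in>UNIV. \<Sum>i\<in>UNIV. \<Sum>j\<in>UNIV. g k * h l * (?I i k * ?I j l * N i j))"
      by (rule sum.cong[OF refl], rule sum.swap)
    finally show ?thesis unfolding sum_distrib_left .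
  qed
  have box: "(\<Sum>i\<in>UNIV. \<Sum>j\<in>UNIV. ?I i k * ?I j l * M i j)
      \<le> (\<Sum>i\<in>UNIV. \<Sum>j\<in>UNIV. ?I i k * ?I j l * (if i = j then 1 else 0))" for k l
  proof (cases "k \<le> l")
    case True
    have "(\<Sum>i\<in>UNIV. \<Sum>j\<in>UNIV. ?I i k * ?I j l * M i j) \<le> (\<Sum>i\<in>UNIV. \<Sum>j\<in>UNIV. ?I i k * M i j)"
      using M(1) by (intro sum_mono) auto
    also have "\<dots> \<le> (\<Sum>i\<in>UNIV. ?I i k)"
      unfolding sum_distrib_left[symmetric] using M(2) by (intro sum_mono) auto
    also have "\<dots> = (\<Sum>i\<in>UNIV. \<Sum>j\<in>UNIV. if i = j then ?I i k * ?I j l else 0)"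
      using True by (intro sum.cong refl) auto
    also have "\<dots> = (\<Sum>i\<in>UNIV. \<Sum>j\<in>UNIV. ?I i k * ?I j l * (if i = j then 1 else 0))"
      by (intro sum.cong refl) auto
    finally show ?thesis .
  next
    case False
    have "(\<Sum>i\<in>UNIV. \<Sum>j\<in>UNIV. ?I i k * ?I j l * M i j) \<le> (\<Sum>i\<in>UNIV. \<Sum>j\<in>UNIV. ?I j l * M i j)"
      using M(1) by (intro sum_mono) auto
    also have "\<dots> = (\<Sum>j\<in>UNIV. \<Sum>i\<in>UNIV. ?I j l * M i j)"
      by (rule sum.swap)
    also have "\<dots> \<le> (\<Sum>j\<in>UNIV. ?I j l)"
      unfolding sum_distrib_left[symmetric] using M(3) by (intro sum_mono) auto
    also have "\<dots> = (\<Sum>i\<in>UNIV. \<Sum>j\<in>UNIV. if i = j then ?I i k * ?I j l else 0)"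
      using False by (intro sum.cong refl) auto
    also have "\<dots> = (\<Sum>i\<in>UNIV. \<Sum>j\<in>UNIV. ?I i k * ?I j l * (if i = j then 1 else 0))"
      by (intro sum.cong refl) auto
    finally show ?thesis .
  qed
  have "(\<Sum>i\<in>UNIV. \<Sum>j\<in>UNIV. c i * s j * M i j)
      \<le> (\<Sum>i\<in>UNIV. \<Sum>j\<in>UNIV. c i * s j * (if i = j then 1 else 0))"
    unfolding expand 
    by (rule sum_mono, rule sum_mono, rule mult_left_mono[OF box]) (use g(1) h(1) in auto)
  also have "\<dots> = (\<Sum>i\<in>UNIV. \<Sum>j\<in>UNIV. if i = j then c i * s j else 0)"
    by (intro sum.cong refl) auto
  also have "\<dots> = (\<Sum>i\<in>UNIV. c i * s i)" by simp
  finally show ?thesis .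
qed

lemma diag_sandwich_nth:
  "(U ** diag e ** transpose V) $ a $ b = (\<Sum>i\<in>UNIV. e $ i * (U $ a $ i * V $ b $ i))"
  by (simp add: matrix_matrix_mult_def diag_def transpose_def if_distrib[of "\<lambda>x. _ * x"]
      sum.delta' mult_ac cong: if_cong)

lemma diag_sandwich_linear:
  "U ** diag (a + b) ** transpose V = U ** diag a ** transpose V + U ** diag b ** transpose V"
  "U ** diag (a - b) ** transpose V = U ** diag a ** transpose V - U ** diag b ** transpose V"
  "U ** diag (r *\<^sub>R a) ** transpose V = r *\<^sub>R (U ** diag a ** transpose V)"
  by (simp_all add: vec_eq_iff diag_sandwich_nth sum.distrib sum_subtractf sum_distrib_left
      algebra_simps)

lemma inner_diag_sandwich:
  fixes U P :: "real^'m^'a" and V Q :: "real^'m^'b"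
  shows "(U ** diag e ** transpose V) \<bullet> (P ** diag s ** transpose Q)
    = (\<Sum>i\<in>UNIV. \<Sum>j\<in>UNIV. e $ i * s $ j *
         ((column i U \<bullet> column j P) * (column i V \<bullet> column j Q)))"
proof -
  let ?t = "\<lambda>a b i j. e $ i * s $ j * ((U $ a $ i * P $ a $ j) * (V $ b $ i * Q $ b $ j))"
  have "(U ** diag e ** transpose V) \<bullet> (P ** diag s ** transpose Q)
      = (\<Sum>a\<in>UNIV. \<Sum>b\<in>UNIV. \<Sum>i\<in>UNIV. \<Sum>j\<in>UNIV. ?t a b i j)"
    unfolding inner_vec_def diag_sandwich_nth inner_real_def sum_product
    by (intro sum.cong refl) (simp only: mult_ac)
  also have "\<dots> = (\<Sum>a\<in>UNIV. \<Sum>i\<in>UNIV. \<Sum>b\<in>UNIV. \<Sum>j\<in>UNIV. ?t a b i j)"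
    by (intro sum.cong refl) (rule sum.swap)
  also have "\<dots> = (\<Sum>i\<in>UNIV. \<Sum>a\<in>UNIV. \<Sum>b\<in>UNIV. \<Sum>j\<in>UNIV. ?t a b i j)"
    by (rule sum.swap)
  also have "\<dots> = (\<Sum>i\<in>UNIV. \<Sum>a\<in>UNIV. \<Sum>j\<in>UNIV. \<Sum>b\<in>UNIV. ?t a b i j)"
    by (intro sum.cong refl) (rule sum.swap)
  also have "\<dots> = (\<Sum>i\<in>UNIV. \<Sum>j\<in>UNIV. \<Sum>a\<in>UNIV. \<Sum>b\<in>UNIV. ?t a b i j)"
    by (intro sum.cong refl) (rule sum.swap)
  also have "\<dots> = (\<Sum>i\<in>UNIV. \<Sum>j\<in>UNIV. e $ i * s $ j *
         ((column i U \<bullet> column j P) * (column i V \<bullet> column j Q)))"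
    by (simp only: inner_vec_def column_def inner_real_def vec_lambda_beta sum_product
        sum_distrib_left[symmetric])
  finally show ?thesis .
qed

lemma orthonormal_columns:
  fixes Q :: "real^'m^'b"
  assumes "transpose Q ** Q = mat 1"
  shows "column i Q \<bullet> column j Q = (if i = j then 1 else 0)"
proof -
  have "(transpose Q ** Q) $ i $ j = column i Q \<bullet> column j Q"
    by (simp add: matrix_matrix_mult_def transpose_def column_def inner_vec_def)
  then show ?thesis using assms by (simp add: mat_def)
qed

lemma bessel_columns:
  fixes Q :: "real^'m^'b"
  assumes "transpose Q ** Q = mat 1"
  shows "(\<Sum>j\<in>UNIV. (x \<bullet> column j Q)\<^sup>2) \<le> x \<bullet> x"
proof -
  define y where "y = (\<Sum>j\<in>UNIV. (x \<bullet> column j Q) *\<^sub>R column j Q)"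
  have yy: "y \<bullet> y = (\<Sum>j\<in>UNIV. (x \<bullet> column j Q)\<^sup>2)"
    by (simp add: y_def inner_sum_left inner_sum_right orthonormal_columns[OF assms]
        if_distrib[of "\<lambda>x. _ * x"] power2_eq_square cong: if_cong)
  have xy: "x \<bullet> y = (\<Sum>j\<in>UNIV. (x \<bullet> column j Q)\<^sup>2)"
    by (simp add: y_def inner_sum_right power2_eq_square)
  have "0 \<le> (x - y) \<bullet> (x - y)" by simp
  also have "\<dots> = x \<bullet> x - 2 * (x \<bullet> y) + y \<bullet> y"
    by (simp add: inner_diff_left inner_diff_right inner_commute)
  finally show ?thesis using yy xy by linarith
qed

lemma inner_diag_sandwich_same:
  fixes U :: "real^'m^'a" and V :: "real^'m^'b"
  assumes "transpose U ** U = mat 1" "transpose V ** V = mat 1"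
  shows "(U ** diag a ** transpose V) \<bullet> (U ** diag b ** transpose V) = a \<bullet> b"
  unfolding inner_diag_sandwich orthonormal_columns[OF assms(1)] orthonormal_columns[OF assms(2)]
  by (simp add: inner_vec_def if_distrib[of "\<lambda>x. _ * x"] cong: if_cong)

lemma norm_diag_sandwich:
  fixes U :: "real^'m^'a" and V :: "real^'m^'b"
  assumes "transpose U ** U = mat 1" "transpose V ** V = mat 1"
  shows "norm (U ** diag a ** transpose V) = norm a"
  unfolding norm_eq_sqrt_inner inner_diag_sandwich_same[OF assms] ..

text \<open>
  In the two orthonormal systems the inner product is a bilinear form in \<open>e\<close> and \<open>s\<close> whose
  coefficients are, in absolute value, doubly substochastic by Bessel's inequality. The spectrum \<open>e\<close> may have
  arbitrary signs and order as long as a decreasing \<open>c\<close> dominates it: for subgradients at a singular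
  matrix, the entries of \<open>e\<close> on the kernel are not sorted.
\<close>
lemma von_neumann_trace:
  fixes U P :: "('a::finite, 'm::{finite,linorder}) rmat" and V Q :: "('b::finite, 'm) rmat"
  assumes orth: "transpose U ** U = mat 1" "transpose V ** V = mat 1"
      "transpose P ** P = mat 1" "transpose Q ** Q = mat 1"
    and c: "antimono c" "\<And>i. \<bar>e $ i\<bar> \<le> c i"
    and s: "antimono (($) s)" "\<And>i. 0 \<le> s $ i"
  shows "(U ** diag e ** transpose V) \<bullet> (P ** diag s ** transpose Q) \<le> (\<Sum>i\<in>UNIV. c i * s $ i)"
proof -
  define M where "M i j = \<bar>(column i U \<bullet> column j P) * (column i V \<bullet> column j Q)\<bar>" for i j
  have amgm: "\<bar>x * y\<bar> \<le> (x\<^sup>2 + y\<^sup>2) / 2" for x y :: real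
    using sum_squares_bound[of "\<bar>x\<bar>" "\<bar>y\<bar>"] by (simp add: abs_mult)
  have c0: "0 \<le> c i" for i using c(2)[of i] by linarith
  have row: "(\<Sum>j\<in>UNIV. M i j) \<le> 1" for i
  proof -
    have "(\<Sum>j\<in>UNIV. M i j) \<le> (\<Sum>j\<in>UNIV. ((column i U \<bullet> column j P)\<^sup>2 + (column i V \<bullet> column j Q)\<^sup>2) / 2)"
      unfolding M_def by (intro sum_mono amgm)
    also have "\<dots> \<le> 1"
      using bessel_columns[OF orth(3), of "column i U"] bessel_columns[OF orth(4), of "column i V"]
        orthonormal_columns[OF orth(1), of i i] orthonormal_columns[OF orth(2), of i i]
      by (simp add: sum.distrib add_divide_distrib sum_divide_distrib[symmetric])
    finally show ?thesis .
  qed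
  have col: "(\<Sum>i\<in>UNIV. M i j) \<le> 1" for j
  proof -
    have "(\<Sum>i\<in>UNIV. M i j) \<le> (\<Sum>i\<in>UNIV. ((column i U \<bullet> column j P)\<^sup>2 + (column i V \<bullet> column j Q)\<^sup>2) / 2)"
      unfolding M_def by (intro sum_mono amgm)
    also have "\<dots> \<le> 1"
      using bessel_columns[OF orth(1), of "column j P"] bessel_columns[OF orth(2), of "column j Q"]
        orthonormal_columns[OF orth(3), of j j] orthonormal_columns[OF orth(4), of j j]
      by (simp add: sum.distrib add_divide_distrib sum_divide_distrib[symmetric] inner_commute)
    finally show ?thesis .
  qed
  have "(U ** diag e ** transpose V) \<bullet> (P ** diag s ** transpose Q)
      \<le> (\<Sum>i\<in>UNIV. \<Sum>j\<in>UNIV. c i * s $ j * M i j)"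
    unfolding inner_diag_sandwich
  proof (intro sum_mono)
    fix i j
    let ?z = "(column i U \<bullet> column j P) * (column i V \<bullet> column j Q)"
    have "e $ i * s $ j * ?z \<le> \<bar>e $ i\<bar> * s $ j * \<bar>?z\<bar>"
      using s(2)[of j] abs_ge_self[of "e $ i * s $ j * ?z"] by (simp add: abs_mult)
    also have "\<dots> \<le> c i * s $ j * \<bar>?z\<bar>"
      using c(2)[of i] s(2)[of j] by (intro mult_right_mono) auto
    finally show "e $ i * s $ j * ?z \<le> c i * s $ j * M i j" by (simp add: M_def)
  qed
  also have "\<dots> \<le> (\<Sum>i\<in>UNIV. c i * s $ i)"
    by (rule substochastic_rearrangement[OF c(1) c0 s(1) s(2) _ row col]) (simp add: M_def)
  finally show ?thesis .
qed

section \<open>Stability and uniqueness of singular values\<close>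
lemma is_svdD:
  assumes "is_svd A U s V"
  shows "transpose U ** U = mat 1" "transpose V ** V = mat 1" "\<And>i. 0 \<le> s $ i"
    "antimono (($) s)" "A = U ** diag s ** transpose V"
  using assms by (auto simp: is_svd_def orthogonal_matrix)

lemma svd_inner_le:
  assumes "is_svd A U s V" "is_svd B P t Q"
  shows "A \<bullet> B \<le> s \<bullet> t"
  unfolding is_svdD(5)[OF assms(1)] is_svdD(5)[OF assms(2)] inner_vec_def[of s t] inner_real_def
  by (intro von_neumann_trace is_svdD(1,2,4)[OF assms(1)] is_svdD(1,2,4)[OF assms(2)])
     (use is_svdD(3)[OF assms(1)] is_svdD(3)[OF assms(2)] in auto)

lemma svd_norm:
  assumes "is_svd A U s V" shows "norm A = norm s"
  using norm_diag_sandwich[OF is_svdD(1,2)[OF assms]] is_svdD(5)[OF assms] by metis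

text \<open>
  Mirsky's inequality. Expanding both squares, it is the trace inequality, because a matrix and its
  vector of singular values have the same norm.
\<close>
lemma svd_norm_diff_le:
  assumes "is_svd A U s V" "is_svd B P t Q"
  shows "norm (s - t) \<le> norm (A - B)"
proof (rule power2_le_imp_le)
  show "(norm (s - t))\<^sup>2 \<le> (norm (A - B))\<^sup>2"
    using svd_inner_le[OF assms] svd_norm[OF assms(1)] svd_norm[OF assms(2)]
    unfolding norm_eq power2_norm_eq_inner
    by (simp add: inner_diff_left inner_diff_right inner_commute)
qed simp

text \<open>
  Two decompositions of the same matrix are at distance 0, so Mirsky's inequality gives uniqueness.
\<close>
lemma singular_values_eq:
  assumes "is_svd A U s V" shows "singular_values A = s"
  unfolding singular_values_def
proof (rule the_equality)
  show "\<exists>U V. is_svd A U s V" using assms by blast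
next
  fix t assume "\<exists>U V. is_svd A U t V"
  then obtain P Q where "is_svd A P t Q" by blast
  from svd_norm_diff_le[OF this assms] show "t = s" by simp
qed

section \<open>Existence of the singular value decomposition\<close>
lemma unit_vector_orthogonal_to_few:
  fixes u :: "'i \<Rightarrow> 'a::euclidean_space"
  assumes "finite I" "card I < DIM('a)"
  shows "\<exists>x. norm x = 1 \<and> (\<forall>i\<in>I. x \<bullet> u i = 0)"
proof -
  have "dim (u ` I) < DIM('a)"
    using dim_le_card'[of "u ` I"] card_image_le[OF assms(1), of u] assms by auto
  then obtain x where x: "x \<noteq> 0" "\<And>y. y \<in> span (u ` I) \<Longrightarrow> orthogonal x y"
    using orthogonal_to_subspace_exists by blast
  then have "(x /\<^sub>R norm x) \<bullet> u i = 0" if "i \<in> I" for i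
    using that span_base[of "u i" "u ` I"] by (auto simp: orthogonal_def)
  then show ?thesis using x(1) by (intro exI[of _ "x /\<^sub>R norm x"]) auto
qed

text \<open>
  Maximise \<open>x \<bullet> (A *v y)\<close> over unit vectors orthogonal to the pairs found so far. No differentiation is
  needed at the maximiser: \<open>A *v y\<close> is itself orthogonal to the old left vectors, so it has norm at most
  \<open>t\<close>, and a vector of norm at most \<open>t\<close> whose inner product with the unit vector \<open>x\<close> is \<open>t\<close> equals
  \<open>t *\<^sub>R x\<close>. The final clause is kept so that later pairs are seen to have smaller singular values.
\<close>
lemma greedy_singular_pair:
  fixes A :: "real^'n^'m" and u :: "'i \<Rightarrow> real^'m" and v :: "'i \<Rightarrow> real^'n"
  assumes I: "finite I" "card I < CARD('m)" "card I < CARD('n)"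
    and pairs: "\<And>i. i \<in> I \<Longrightarrow> A *v v i = s i *\<^sub>R u i" "\<And>i. i \<in> I \<Longrightarrow> transpose A *v u i = s i *\<^sub>R v i"
  shows "\<exists>x y t. norm x = 1 \<and> norm y = 1 \<and> (\<forall>i\<in>I. x \<bullet> u i = 0) \<and> (\<forall>i\<in>I. y \<bullet> v i = 0) \<and> 0 \<le> t \<and>
    A *v y = t *\<^sub>R x \<and> transpose A *v x = t *\<^sub>R y \<and>
    (\<forall>w z. (\<forall>i\<in>I. w \<bullet> u i = 0) \<longrightarrow> (\<forall>i\<in>I. z \<bullet> v i = 0) \<longrightarrow> w \<bullet> (A *v z) \<le> t * norm w * norm z)"
proof -
  define K where "K = (sphere 0 1 \<inter> (\<Inter>i\<in>I. {x. x \<bullet> u i = 0})) \<times> (sphere 0 1 \<inter> (\<Inter>i\<in>I. {y. y \<bullet> v i = 0}))"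
  have "compact K"
    unfolding K_def
    by (intro compact_Times compact_Int_closed compact_sphere closed_INT ballI closed_Collect_eq
        continuous_intros)
  moreover obtain x0 y0 where xy0: "(x0, y0) \<in> K"
    using unit_vector_orthogonal_to_few[OF I(1), of u] unit_vector_orthogonal_to_few[OF I(1), of v] I
    by (auto simp: K_def)
  moreover have "continuous_on K (\<lambda>q. fst q \<bullet> (A *v snd q))"
    by (intro continuous_intros matrix_vector_mult_linear_continuous_on[THEN continuous_on_compose2])
       auto
  ultimately obtain q where q: "q \<in> K" "\<And>r. r \<in> K \<Longrightarrow> fst r \<bullet> (A *v snd r) \<le> fst q \<bullet> (A *v snd q)"
    using continuous_attains_sup[of K] by blast
  obtain x y where xy: "q = (x, y)" by force
  define t where "t = x \<bullet> (A *v y)"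
  have x: "norm x = 1" "\<And>i. i \<in> I \<Longrightarrow> x \<bullet> u i = 0" and y: "norm y = 1" "\<And>i. i \<in> I \<Longrightarrow> y \<bullet> v i = 0"
    using q(1) by (auto simp: K_def xy)
  have t_max_unit: "w \<bullet> (A *v z) \<le> t" if "(w, z) \<in> K" for w z
    using q(2)[OF that] by (simp add: xy t_def)
  have t0: "0 \<le> t"
  proof -
    have "(- x, y) \<in> K" using q(1) by (auto simp: K_def xy)
    from t_max_unit[OF this] show ?thesis by (simp add: t_def)
  qed
  have t_max: "w \<bullet> (A *v z) \<le> t * norm w * norm z"
    if "\<forall>i\<in>I. w \<bullet> u i = 0" "\<forall>i\<in>I. z \<bullet> v i = 0" for w z
  proof (cases "w = 0 \<or> z = 0")
    case False
    have "(w /\<^sub>R norm w, z /\<^sub>R norm z) \<in> K" using that False by (auto simp: K_def)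
    from t_max_unit[OF this] show ?thesis
      using False by (simp add: matrix_vector_mult_scaleR divide_simps mult_ac)
  qed auto
  have eq_of_max: "a = t *\<^sub>R b" if "norm b = 1" "b \<bullet> a = t" "a \<bullet> a \<le> t * norm a"
    for a b :: "'c::real_inner"
  proof -
    have "(norm a)\<^sup>2 \<le> t * norm a" using that(3) by (simp add: power2_norm_eq_inner)
    then have "norm a \<le> t" using t0 by (cases "a = 0") (auto simp: power2_eq_square)
    then have "a \<bullet> a \<le> t * t" using t0 by (simp add: power2_norm_eq_inner[symmetric] power2_eq_square mult_mono)
    moreover have "(a - t *\<^sub>R b) \<bullet> (a - t *\<^sub>R b) = a \<bullet> a - t * t"
      using that(1,2) by (simp add: inner_diff_left inner_diff_right inner_commute norm_eq_1 algebra_simps)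
    ultimately have "(a - t *\<^sub>R b) \<bullet> (a - t *\<^sub>R b) \<le> 0" by linarith
    then show ?thesis by (metis eq_iff_diff_eq_0 inner_eq_zero_iff inner_ge_zero order_antisym)
  qed
  have adj: "w \<bullet> (A *v z) = (transpose A *v w) \<bullet> z" for w z
    by (metis dot_lmul_matrix transpose_matrix_vector)
  have "A *v y = t *\<^sub>R x"
  proof (rule eq_of_max[OF x(1)])
    have "\<forall>i\<in>I. (A *v y) \<bullet> u i = 0"
      using pairs(2) y(2) by (metis adj inner_commute inner_scaleR_right mult_zero_right)
    from t_max[OF this, of y] show "(A *v y) \<bullet> (A *v y) \<le> t * norm (A *v y)" using y by simp
  qed (simp add: t_def)
  moreover have "transpose A *v x = t *\<^sub>R y"
  proof (rule eq_of_max[OF y(1)])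
    have "\<forall>i\<in>I. (transpose A *v x) \<bullet> v i = 0"
      using pairs(1) x(2) by (metis adj inner_scaleR_right mult_zero_right)
    from t_max[OF _ this, of x] show "(transpose A *v x) \<bullet> (transpose A *v x) \<le> t * norm (transpose A *v x)"
      using x by (simp add: adj)
  qed (simp add: t_def adj inner_commute)
  ultimately show ?thesis using x y t0 t_max by blast
qed

text \<open>
  Singular pairs are chosen greedily, one index after the other in increasing order; this produces
  the singular values, zeros included, already sorted.
\<close>
lemma svd_exists:
  fixes A :: "('m::{finite,linorder}, 'n::finite) rmat"
  assumes "CARD('m) \<le> CARD('n)"
  shows "\<exists>U s V. is_svd A U s V"
proof -
  define P where "P I u v s \<longleftrightarrow>
      (\<forall>i\<in>I. \<forall>j\<in>I. u i \<bullet> u j = (if i = j then 1 else 0) \<and> v i \<bullet> v j = (if i = j then 1 else 0) \<and>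
          (i \<le> j \<longrightarrow> s j \<le> s i)) \<and>
      (\<forall>i\<in>I. 0 \<le> s i \<and> A *v v i = s i *\<^sub>R u i \<and> transpose A *v u i = s i *\<^sub>R v i \<and>
        (\<forall>w z. (\<forall>j\<in>I. w \<bullet> u j = 0) \<longrightarrow> (\<forall>j\<in>I. z \<bullet> v j = 0) \<longrightarrow> w \<bullet> (A *v z) \<le> s i * norm w * norm z))"
    for I :: "'m set" and u :: "'m \<Rightarrow> 'm rvec" and v :: "'m \<Rightarrow> 'n rvec" and s
  have "\<exists>u v s. P I u v s" for I
    using finite[of I]
  proof (induction I rule: finite_linorder_max_induct)
    case empty
    show ?case by (simp add: P_def)
  next
    case (insert b I)
    then have "b \<notin> I" by auto
    obtain u v s where "P I u v s" using insert by blast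
    then have u: "\<And>i j. i \<in> I \<Longrightarrow> j \<in> I \<Longrightarrow> u i \<bullet> u j = (if i = j then 1 else 0)"
      and v: "\<And>i j. i \<in> I \<Longrightarrow> j \<in> I \<Longrightarrow> v i \<bullet> v j = (if i = j then 1 else 0)"
      and s: "\<And>i j. i \<in> I \<Longrightarrow> j \<in> I \<Longrightarrow> i \<le> j \<Longrightarrow> s j \<le> s i"
      and pairs: "\<And>i. i \<in> I \<Longrightarrow> 0 \<le> s i" "\<And>i. i \<in> I \<Longrightarrow> A *v v i = s i *\<^sub>R u i"
        "\<And>i. i \<in> I \<Longrightarrow> transpose A *v u i = s i *\<^sub>R v i"
      and bound: "\<And>i w z. i \<in> I \<Longrightarrow> \<forall>j\<in>I. w \<bullet> u j = 0 \<Longrightarrow> \<forall>j\<in>I. z \<bullet> v j = 0 \<Longrightarrow>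
        w \<bullet> (A *v z) \<le> s i * norm w * norm z"
      by (simp_all add: P_def)
    have "card I < CARD('m)"
      using psubset_card_mono[of UNIV I] \<open>b \<notin> I\<close> by auto
    moreover from this have "card I < CARD('n)" using assms by simp
    ultimately obtain x y t where
      xy: "norm x = 1" "norm y = 1" "\<And>i. i \<in> I \<Longrightarrow> x \<bullet> u i = 0" "\<And>i. i \<in> I \<Longrightarrow> y \<bullet> v i = 0"
      and t: "0 \<le> t" "A *v y = t *\<^sub>R x" "transpose A *v x = t *\<^sub>R y"
        "\<And>w z. \<forall>i\<in>I. w \<bullet> u i = 0 \<Longrightarrow> \<forall>i\<in>I. z \<bullet> v i = 0 \<Longrightarrow> w \<bullet> (A *v z) \<le> t * norm w * norm z"
      using greedy_singular_pair[of I A v s u, OF insert(1) _ _ pairs(2,3)] by auto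
    have t_le: "t \<le> s i" if "i \<in> I" for i
    proof -
      have "x \<bullet> (A *v y) \<le> s i * norm x * norm y" using bound[OF that] xy by blast
      then show ?thesis using xy t by (simp add: norm_eq_1)
    qed
    let ?u = "u(b := x)" and ?v = "v(b := y)" and ?s = "s(b := t)"
    have "P (insert b I) ?u ?v ?s"
      unfolding P_def
    proof (intro conjI ballI)
      fix i j assume ij: "i \<in> insert b I" "j \<in> insert b I"
      show "?u i \<bullet> ?u j = (if i = j then 1 else 0)"
        using ij xy \<open>b \<notin> I\<close> u by (auto simp: norm_eq_1 inner_commute)
      show "?v i \<bullet> ?v j = (if i = j then 1 else 0)"
        using ij xy \<open>b \<notin> I\<close> v by (auto simp: norm_eq_1 inner_commute)
      show "i \<le> j \<longrightarrow> ?s j \<le> ?s i"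
        using ij t_le insert(2) s by (auto simp: not_le[symmetric])
    next
      fix i assume i: "i \<in> insert b I"
      show "0 \<le> ?s i" using i t pairs by auto
      show "A *v ?v i = ?s i *\<^sub>R ?u i" using i t pairs by auto
      show "transpose A *v ?u i = ?s i *\<^sub>R ?v i" using i t pairs by auto
      show "\<forall>w z. (\<forall>j\<in>insert b I. w \<bullet> ?u j = 0) \<longrightarrow> (\<forall>j\<in>insert b I. z \<bullet> ?v j = 0) \<longrightarrow>
          w \<bullet> (A *v z) \<le> ?s i * norm w * norm z"
      proof (intro allI impI)
        fix w z assume "\<forall>j\<in>insert b I. w \<bullet> ?u j = 0" "\<forall>j\<in>insert b I. z \<bullet> ?v j = 0"
        then have wz: "\<forall>j\<in>I. w \<bullet> u j = 0" "\<forall>j\<in>I. z \<bullet> v j = 0"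
          using \<open>b \<notin> I\<close> by (auto split: if_splits)
        show "w \<bullet> (A *v z) \<le> ?s i * norm w * norm z"
        proof (cases "i = b")
          case True
          then show ?thesis using t(4)[OF wz] by simp
        next
          case False
          then have "i \<in> I" using i by simp
          then have "w \<bullet> (A *v z) \<le> s i * norm w * norm z" using bound wz by blast
          then show ?thesis using False by simp
        qed
      qed
    qed
    then show ?case by blast
  qed
  then obtain u v s where "P UNIV u v s" by blast
  then have u: "\<And>i j. u i \<bullet> u j = (if i = j then 1 else 0)"
    and v: "\<And>i j. v i \<bullet> v j = (if i = j then 1 else 0)"
    and s: "antimono s" "\<And>i. 0 \<le> s i" "\<And>i. transpose A *v u i = s i *\<^sub>R v i"
    by (simp_all add: P_def antimono_def)
  define U V where "U = (\<chi> a i. u i $ a)" and "V = (\<chi> b i. v i $ b)"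
  have UU: "transpose U ** U = mat 1"
    using u by (simp add: vec_eq_iff mat_def matrix_matrix_mult_def transpose_def U_def inner_vec_def)
  have VV: "transpose V ** V = mat 1"
    using v by (simp add: vec_eq_iff mat_def matrix_matrix_mult_def transpose_def V_def inner_vec_def)
  have orthU: "orthogonal_matrix U" using UU by (simp add: orthogonal_matrix)
  have "transpose A ** U = V ** diag (\<chi> i. s i)"
  proof -
    have "(transpose A ** U) $ b $ i = (V ** diag (\<chi> i. s i)) $ b $ i" for b i
    proof -
      have "(transpose A *v u i) $ b = s i * v i $ b"
        by (simp only: s vector_scaleR_component real_scaleR_def)
      then show ?thesis
        by (simp add: matrix_matrix_mult_def matrix_vector_mult_def diag_def U_def V_def
            if_distrib[of "\<lambda>x. _ * x"] mult_ac cong: if_cong)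
    qed
    then show ?thesis by (simp add: vec_eq_iff)
  qed
  then have "transpose (transpose A ** U) = transpose (V ** diag (\<chi> i. s i))" by simp
  moreover have "transpose (diag (\<chi> i. s i)) = diag (\<chi> i. s i)"
    by (auto simp: transpose_def diag_def vec_eq_iff)
  ultimately have "transpose U ** A = diag (\<chi> i. s i) ** transpose V"
    by (simp add: matrix_transpose_mul)
  then have "U ** (transpose U ** A) = U ** diag (\<chi> i. s i) ** transpose V"
    by (simp add: matrix_mul_assoc)
  then have "A = U ** diag (\<chi> i. s i) ** transpose V"
    using orthU by (simp add: matrix_mul_assoc orthogonal_matrix_def)
  then have "is_svd A U (\<chi> i. s i) V"
    using orthU VV s(1,2) by (auto simp: is_svd_def intro!: antimonoI dest: antimonoD)
  then show ?thesis by blast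
qed

lemma singular_values_svd:
  fixes A :: "('m::{finite,linorder}, 'n::finite) rmat"
  assumes "CARD('m) \<le> CARD('n)"
  obtains U V where "is_svd A U (singular_values A) V"
  using svd_exists[OF assms, of A] singular_values_eq by metis

lemma
  fixes A :: "('m::{finite,linorder}, 'n::finite) rmat"
  assumes "CARD('m) \<le> CARD('n)"
  shows singular_values_nonneg: "0 \<le> singular_values A $ i"
    and singular_values_antimono: "antimono (($) (singular_values A))"
  by (rule singular_values_svd[OF assms, of A], simp add: is_svd_def)+

lemma norm_singular_values_diff_le:
  fixes A B :: "('m::{finite,linorder}, 'n::finite) rmat"
  assumes "CARD('m) \<le> CARD('n)"
  shows "norm (singular_values A - singular_values B) \<le> norm (A - B)"
  by (metis singular_values_svd[OF assms] svd_norm_diff_le)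

lemma singular_values_diff_le:
  fixes A B :: "('m::{finite,linorder}, 'n::finite) rmat"
  assumes "CARD('m) \<le> CARD('n)"
  shows "\<bar>singular_values A $ i - singular_values B $ i\<bar> \<le> norm (A - B)"
  using component_le_norm_cart[of "singular_values A - singular_values B" i]
    norm_singular_values_diff_le[OF assms, of A B] by simp

lemma continuous_singular_value:
  fixes A :: "('m::{finite,linorder}, 'n::finite) rmat"
  assumes "CARD('m) \<le> CARD('n)"
  shows "continuous_on S (\<lambda>A::('m,'n) rmat. singular_values A $ i)"
  by (rule lipschitz_on_continuous_on[of 1], rule lipschitz_onI)
     (auto simp: dist_norm singular_values_diff_le[OF assms])

section \<open>Subgradients of the sum of powers of singular values\<close>
text \<open>
  The quantity on the left measures how far the singular vectors of \<open>B\<close> are from being singular vectors of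
  \<open>A\<close>. That it is of second order in \<open>B - A\<close> is what makes first order expansions at \<open>A\<close> possible.
\<close>
lemma svd_alignment_gap:
  assumes "is_svd A U s V" "is_svd B P t Q"
  shows "s \<bullet> t - A \<bullet> B \<le> (norm (B - A))\<^sup>2 / 2"
proof -
  have "(norm (B - A))\<^sup>2 = (norm s)\<^sup>2 + (norm t)\<^sup>2 - 2 * (A \<bullet> B)"
    unfolding svd_norm[OF assms(1), symmetric] svd_norm[OF assms(2), symmetric] power2_norm_eq_inner
    by (simp add: inner_diff_left inner_diff_right inner_commute)
  moreover have "0 \<le> (norm (s - t))\<^sup>2" by simp
  then have "2 * (s \<bullet> t) \<le> (norm s)\<^sup>2 + (norm t)\<^sup>2"
    unfolding power2_norm_eq_inner by (simp add: inner_diff_left inner_diff_right inner_commute)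
  ultimately show ?thesis by simp
qed

text \<open>
  A linear lower bound for a weighted sum of singular values whose weights need not be decreasing, so
  that the sum need not be convex in the matrix. The trick is to perturb \<open>s\<close> rather than \<open>X\<close>: for a
  small fixed \<open>t\<close>, the spectrum \<open>s + t *\<^sub>R d\<close> is still dominated by a decreasing one, because \<open>d\<close> is
  constant where \<open>s\<close> has ties. The trace inequality for this spectrum, in which the part belonging to
  \<open>s\<close> cancels up to the quadratic \<open>svd_alignment_gap\<close>, gives the claim with \<open>K = 1 / (2 * t)\<close>.
\<close>
lemma singular_values_linear_lower_bound:
  fixes X :: "('m::{finite,linorder}, 'n::finite) rmat"
  assumes dims: "CARD('m) \<le> CARD('n)"
    and svd: "is_svd X U s V"
    and d_const: "\<And>i j. 0 < s $ i \<Longrightarrow> s $ i = s $ j \<Longrightarrow> d $ i = d $ j"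
    and C: "\<And>i. s $ i = 0 \<Longrightarrow> \<bar>d $ i\<bar> \<le> C"
  shows "\<exists>K. \<forall>Z. (U ** diag d ** transpose V) \<bullet> (Z - X)
    \<le> (\<Sum>i\<in>UNIV. (if 0 < s $ i then d $ i else C) * (singular_values Z $ i - s $ i)) + K * (norm (Z - X))\<^sup>2"
proof -
  note [simp] = is_svdD(3)[OF svd]
  define h where "h i = (if 0 < s $ i then d $ i else C)" for i
  define c where "c t i = s $ i + t * h i" for t i
  have c_lim: "((\<lambda>t. c t i) \<longlongrightarrow> s $ i) (at_right 0)" for i
    unfolding c_def by (auto intro!: tendsto_eq_intros)
  have "\<forall>\<^sub>F t in at_right 0. i \<le> j \<longrightarrow> c t j \<le> c t i" for i j
  proof (cases "i \<le> j \<and> s $ i \<noteq> s $ j")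
    case True
    then have "s $ j < s $ i"
      using antimonoD[OF is_svdD(4)[OF svd], of i j] by auto
    then obtain r where "s $ j < r" "r < s $ i" using dense by blast
    then have "\<forall>\<^sub>F t in at_right 0. c t j < r \<and> r < c t i"
      using order_tendstoD[OF c_lim] by (intro eventually_conj) auto
    then show ?thesis by eventually_elim auto
  next
    case False
    then have "i \<le> j \<longrightarrow> c t j = c t i" for t
      using d_const[of i j] by (auto simp: c_def h_def)
    then show ?thesis by simp
  qed
  then have 1: "\<forall>\<^sub>F t in at_right 0. \<forall>i j. i \<le> j \<longrightarrow> c t j \<le> c t i"
    by (intro eventually_all_finite)
  have "\<forall>\<^sub>F t in at_right 0. \<bar>s $ i + t * d $ i\<bar> \<le> c t i" for i
  proof (cases "0 < s $ i")
    case True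
    have "\<forall>\<^sub>F t in at_right 0. 0 < c t i"
      using order_tendstoD(1)[OF c_lim True] .
    then show ?thesis by eventually_elim (use True in \<open>auto simp: c_def h_def\<close>)
  next
    case False
    then have "s $ i = 0" using is_svdD(3)[OF svd, of i] by linarith
    have "\<forall>\<^sub>F t in at_right 0. (0::real) < t" by (simp add: eventually_at_right_less)
    then show ?thesis
      by eventually_elim (use C[of i] \<open>s $ i = 0\<close> in \<open>auto simp: c_def h_def abs_mult\<close>)
  qed
  then have 2: "\<forall>\<^sub>F t in at_right 0. \<forall>i. \<bar>s $ i + t * d $ i\<bar> \<le> c t i"
    by (intro eventually_all_finite)
  have 3: "\<forall>\<^sub>F t in at_right 0. (0::real) < t" by (simp add: eventually_at_right_less)
  have "\<forall>\<^sub>F t in at_right 0. 0 < t \<and> (\<forall>i j. i \<le> j \<longrightarrow> c t j \<le> c t i) \<and> (\<forall>i. \<bar>s $ i + t * d $ i\<bar> \<le> c t i)"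
    using 1 2 3 by eventually_elim blast
  from eventually_happens'[OF trivial_limit_at_right_real this]
  obtain t where t: "0 < t" "\<And>i j. i \<le> j \<Longrightarrow> c t j \<le> c t i" "\<And>i. \<bar>s $ i + t * d $ i\<bar> \<le> c t i"
    by auto
  let ?G = "U ** diag d ** transpose V"
  have "?G \<bullet> (Z - X) \<le> (\<Sum>i\<in>UNIV. h i * (singular_values Z $ i - s $ i)) + 1 / (2 * t) * (norm (Z - X))\<^sup>2" for Z
  proof -
    obtain P Q where Z: "is_svd Z P (singular_values Z) Q" using singular_values_svd[OF dims] .
    have "X \<bullet> Z + t * (?G \<bullet> Z) = (U ** diag (s + t *\<^sub>R d) ** transpose V) \<bullet> Z"
      by (simp add: diag_sandwich_linear is_svdD(5)[OF svd, symmetric] inner_add_left)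
    also have "\<dots> = (U ** diag (s + t *\<^sub>R d) ** transpose V) \<bullet> (P ** diag (singular_values Z) ** transpose Q)"
      using is_svdD(5)[OF Z] by simp
    also have "\<dots> \<le> (\<Sum>i\<in>UNIV. c t i * singular_values Z $ i)"
      using t(2,3) by (intro von_neumann_trace is_svdD(1,2)[OF svd] is_svdD(1-4)[OF Z]) (auto intro: antimonoI)
    also have "\<dots> = s \<bullet> singular_values Z + t * (\<Sum>i\<in>UNIV. h i * singular_values Z $ i)"
      by (simp add: c_def inner_vec_def algebra_simps sum.distrib sum_distrib_left)
    finally have "t * (?G \<bullet> Z) \<le> t * (\<Sum>i\<in>UNIV. h i * singular_values Z $ i) + (norm (Z - X))\<^sup>2 / 2"
      using svd_alignment_gap[OF svd Z] by linarith
    then have "?G \<bullet> Z \<le> (\<Sum>i\<in>UNIV. h i * singular_values Z $ i) + 1 / (2 * t) * (norm (Z - X))\<^sup>2"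
      using t(1) by (simp add: field_simps)
    moreover have "?G \<bullet> X = d \<bullet> s"
      by (subst is_svdD(5)[OF svd]) (rule inner_diag_sandwich_same[OF is_svdD(1,2)[OF svd]])
    moreover have "d \<bullet> s = (\<Sum>i\<in>UNIV. h i * s $ i)"
      unfolding inner_vec_def by (intro sum.cong) (auto simp: h_def less_le)
    ultimately show ?thesis
      by (simp add: inner_diff_right right_diff_distrib sum_subtractf)
  qed
  then show ?thesis unfolding h_def by blast
qed

text \<open>
  At \<open>s = 0\<close> the slope \<open>h\<close> is arbitrary, as \<open>x powr p\<close> has infinite slope there.
\<close>
lemma powr_linear_lower_bound:
  fixes s h p e :: real
  assumes p: "0 < p" "p < 1" and "0 \<le> s" "0 < e" and h: "0 < s \<Longrightarrow> h = p * s powr (p - 1)"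
  shows "\<forall>\<^sub>F x in nhds s. 0 \<le> x \<longrightarrow> h * (x - s) - e * \<bar>x - s\<bar> \<le> x powr p - s powr p"
proof (cases "s = 0")
  case True
  \<comment> \<open>Below \<open>b\<close> the slope \<open>x powr (p - 1)\<close> of the chord from 0 is at least \<open>\<bar>h\<bar> + 1\<close>.\<close>
  define b where "b = (\<bar>h\<bar> + 1) powr (1 / (p - 1))"
  have "0 < b" by (simp add: b_def)
  then have "\<forall>\<^sub>F x in nhds 0. x < b" using order_tendstoD(2)[OF tendsto_ident_at] eventually_nhds_in_open[of "{..<b}" 0] by auto
  then show ?thesis unfolding True
  proof eventually_elim
    case (elim x)
    show ?case
    proof (cases "0 < x")
      case True
      have "h \<le> b powr (p - 1)" using p by (simp add: b_def powr_powr)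
      also have "\<dots> \<le> x powr (p - 1)" using p True elim by (intro powr_mono2') auto
      finally have "h * x \<le> x powr (p - 1) * x" using True by simp
      also have "\<dots> = x powr p" using True by (simp add: powr_diff)
      finally show ?thesis using assms True by (smt (verit) mult_nonneg_nonneg powr_zero_eq_one zero_less_abs_iff powr_0)
    qed (use p in auto)
  qed
next
  case False
  then have s: "0 < s" using assms by simp
  have "((\<lambda>x. x powr p) has_field_derivative h) (at s)"
    using s h[OF s] by (auto intro!: derivative_eq_intros)
  then have "((\<lambda>x. (x powr p - s powr p) / (x - s)) \<longlongrightarrow> h) (at s)"
    by (simp add: has_field_derivative_iff)
  from tendstoD[OF this \<open>0 < e\<close>]
  have "\<forall>\<^sub>F x in nhds s. x \<noteq> s \<longrightarrow> \<bar>(x powr p - s powr p) / (x - s) - h\<bar> < e"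
    by (simp add: eventually_at_filter dist_real_def)
  then show ?thesis
  proof eventually_elim
    case (elim x)
    show ?case
    proof (cases "x = s")
      case False
      let ?q = "(x powr p - s powr p) / (x - s)"
      have "\<bar>(?q - h) * (x - s)\<bar> \<le> e * \<bar>x - s\<bar>"
        unfolding abs_mult using elim False by (intro mult_right_mono) auto
      moreover have "(?q - h) * (x - s) = x powr p - s powr p - h * (x - s)"
        using False by (subst left_diff_distrib) simp
      ultimately show ?thesis by linarith
    qed simp
  qed
qed

lemma frechet_subdifferentialI:
  assumes "\<And>e. 0 < e \<Longrightarrow> \<forall>\<^sub>F Z in nhds X. - e * norm (Z - X) \<le> F Z - F X - V \<bullet> (Z - X)"
  shows "V \<in> frechet_subdifferential F X"
proof -
  have "\<forall>\<^sub>F Z in at X. y < ereal ((F Z - F X - V \<bullet> (Z - X)) / norm (Z - X))" if "y < 0" for y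
  proof -
    obtain r where r: "y \<le> ereal r" "r < 0"
    proof (cases y)
      case MInf
      then show ?thesis using that[of "-1"] by simp
    qed (use \<open>y < 0\<close> that in auto)
    have "\<forall>\<^sub>F Z in at X. - (- r / 2) * norm (Z - X) \<le> F Z - F X - V \<bullet> (Z - X)"
      using assms[of "- r / 2"] r(2) by (auto simp: eventually_at_filter elim: eventually_mono)
    moreover have "\<forall>\<^sub>F Z in at X. Z \<noteq> X" by (simp add: eventually_at_filter)
    ultimately show ?thesis
    proof eventually_elim
      case (elim Z)
      then have pos: "0 < norm (Z - X)" by simp
      have "r * norm (Z - X) < r / 2 * norm (Z - X)"
        using r(2) pos by (intro mult_strict_right_mono) auto
      also have "\<dots> \<le> F Z - F X - V \<bullet> (Z - X)" using elim(1) by simp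
      finally have "r < (F Z - F X - V \<bullet> (Z - X)) / norm (Z - X)"
        using pos by (simp add: pos_less_divide_eq)
      then show ?case using r(1) by (metis ereal_less(2) le_less_trans less_ereal.simps(1))
    qed
  qed
  then show ?thesis unfolding frechet_subdifferential_def by (simp add: le_Liminf_iff)
qed

text \<open>
  Near \<open>X\<close>, each power of a singular value lies above a linear function of that singular value up to a
  first order error, and the resulting linear combination of singular values lies above a linear function
  of the matrix up to a second order error.
\<close>
lemma frechet_subdifferential_objective:
  fixes f :: "('m::{finite,linorder}, 'n::finite) rmat \<Rightarrow> real"
  assumes dims: "CARD('m) \<le> CARD('n)" and p: "0 < p" "p < 1" and lam: "0 < lam"
    and grad: "GDERIV f X :> g"
    and svd: "is_svd X U s V"
    and d: "\<And>i. 0 < s $ i \<Longrightarrow> d $ i = p * s $ i powr (p - 1)"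
  shows "g + lam *\<^sub>R (U ** diag d ** transpose V) \<in> frechet_subdifferential (objective f lam p) X"
proof (rule frechet_subdifferentialI)
  fix e :: real assume "0 < e"
  let ?G = "U ** diag d ** transpose V" and ?sv = "\<lambda>Z::('m, 'n) rmat. singular_values Z"
  \<comment> \<open>An upper bound for all \<open>\<bar>d $ i\<bar>\<close>; it replaces the unsorted entries on the zero singular values.\<close>
  define C where "C = norm d"
  define h where "h i = (if 0 < s $ i then d $ i else C)" for i
  have s: "?sv X = s" by (rule singular_values_eq[OF svd])
  obtain K where K: "\<And>Z. ?G \<bullet> (Z - X) \<le> (\<Sum>i\<in>UNIV. h i * (?sv Z $ i - s $ i)) + K * (norm (Z - X))\<^sup>2"
    using singular_values_linear_lower_bound[OF dims svd, of d C] d component_le_norm_cart[of d]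
    unfolding C_def h_def by fastforce
  \<comment> \<open>The error \<open>e\<close> is split into three equal parts: for \<open>f\<close>, for the powers, and for the quadratic term.\<close>
  define e1 where "e1 = e / (3 * lam * CARD('m))"
  have e1: "0 < e1" using \<open>0 < e\<close> lam by (simp add: e1_def)
  have "\<forall>\<^sub>F Z in nhds X. h i * (?sv Z $ i - s $ i) - e1 * \<bar>?sv Z $ i - s $ i\<bar> \<le> ?sv Z $ i powr p - s $ i powr p" for i
  proof -
    have "((\<lambda>Z. ?sv Z $ i) \<longlongrightarrow> s $ i) (nhds X)"
      using continuous_singular_value[OF dims, of UNIV i]
      by (metis UNIV_I continuous_on_eq_continuous_at isCont_def open_UNIV s tendsto_at_iff_tendsto_nhds)
    moreover have "\<forall>\<^sub>F x in nhds (s $ i). 0 \<le> x \<longrightarrow> h i * (x - s $ i) - e1 * \<bar>x - s $ i\<bar> \<le> x powr p - s $ i powr p"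
      using p is_svdD(3)[OF svd] e1 d by (intro powr_linear_lower_bound) (auto simp: h_def)
    ultimately have "\<forall>\<^sub>F Z in nhds X. 0 \<le> ?sv Z $ i \<longrightarrow> h i * (?sv Z $ i - s $ i) - e1 * \<bar>?sv Z $ i - s $ i\<bar> \<le> ?sv Z $ i powr p - s $ i powr p"
      by (rule eventually_compose_filterlim[rotated])
    then show ?thesis using singular_values_nonneg[OF dims] by simp
  qed
  then have ev1: "\<forall>\<^sub>F Z in nhds X. \<forall>i. h i * (?sv Z $ i - s $ i) - e1 * \<bar>?sv Z $ i - s $ i\<bar> \<le> ?sv Z $ i powr p - s $ i powr p"
    by (intro eventually_all_finite)
  have "\<forall>e>0. \<exists>r>0. \<forall>Z. norm (Z - X) < r \<longrightarrow> norm (f Z - f X - (Z - X) \<bullet> g) \<le> e * norm (Z - X)"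
    using grad unfolding gderiv_def has_derivative_at_alt by simp
  then obtain r where r: "0 < r" "\<And>Z. norm (Z - X) < r \<Longrightarrow> norm (f Z - f X - (Z - X) \<bullet> g) \<le> e / 3 * norm (Z - X)"
    using \<open>0 < e\<close> by (metis divide_pos_pos zero_less_numeral)
  define r' where "r' = min r (e / (3 * lam * (\<bar>K\<bar> + 1)))"
  have "0 < r'" using r \<open>0 < e\<close> lam by (simp add: r'_def)
  then have ev2: "\<forall>\<^sub>F Z in nhds X. norm (Z - X) < r'"
    unfolding eventually_nhds_metric dist_norm by blast
  show "\<forall>\<^sub>F Z in nhds X. - e * norm (Z - X) \<le> objective f lam p Z - objective f lam p X - (g + lam *\<^sub>R ?G) \<bullet> (Z - X)"
    using ev1 ev2
  proof eventually_elim
    case (elim Z)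
    let ?n = "norm (Z - X)"
    have f: "- (e / 3) * ?n \<le> f Z - f X - g \<bullet> (Z - X)"
    proof -
      have "\<bar>f Z - f X - (Z - X) \<bullet> g\<bar> \<le> e / 3 * ?n"
        using r(2)[of Z] elim(2) unfolding r'_def real_norm_def by simp
      then show ?thesis unfolding inner_commute[of "Z - X" g] by linarith
    qed
    have "K * ?n\<^sup>2 \<le> (\<bar>K\<bar> + 1) * ?n * ?n"
      by (auto simp: power2_eq_square mult.assoc intro!: mult_right_mono)
    also have "\<dots> \<le> e / (3 * lam) * ?n"
    proof (rule mult_right_mono)
      have cancel: "M * (e / (3 * lam * M)) = e / (3 * lam)" if "0 < M" for M
        using lam that by (simp add: field_simps)
      have "(\<bar>K\<bar> + 1) * ?n \<le> (\<bar>K\<bar> + 1) * (e / (3 * lam * (\<bar>K\<bar> + 1)))"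
        using elim(2) by (intro mult_left_mono) (auto simp: r'_def)
      also have "\<dots> = e / (3 * lam)" using cancel[of "\<bar>K\<bar> + 1"] by simp
      finally show "(\<bar>K\<bar> + 1) * ?n \<le> e / (3 * lam)" .
    qed simp
    finally have K': "K * ?n\<^sup>2 \<le> e / (3 * lam) * ?n" .
    have "(\<Sum>i\<in>UNIV. h i * (?sv Z $ i - s $ i)) - e / (3 * lam) * ?n = (\<Sum>i\<in>UNIV. h i * (?sv Z $ i - s $ i) - e1 * ?n)"
      using lam by (simp add: sum_subtractf e1_def)
    also have "\<dots> \<le> (\<Sum>i\<in>UNIV. ?sv Z $ i powr p - s $ i powr p)"
    proof (rule sum_mono)
      fix i
      have "e1 * \<bar>?sv Z $ i - s $ i\<bar> \<le> e1 * ?n"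
        using e1 singular_values_diff_le[OF dims, of Z i X] unfolding s by (intro mult_left_mono) auto
      then show "h i * (?sv Z $ i - s $ i) - e1 * ?n \<le> ?sv Z $ i powr p - s $ i powr p"
        using elim(1)[rule_format, of i] by linarith
    qed
    finally have "?G \<bullet> (Z - X) - 2 * (e / (3 * lam)) * ?n \<le> (\<Sum>i\<in>UNIV. ?sv Z $ i powr p - s $ i powr p)"
      using K[of Z] K' by linarith
    then have "lam * (?G \<bullet> (Z - X) - 2 * (e / (3 * lam)) * ?n) \<le> lam * (\<Sum>i\<in>UNIV. ?sv Z $ i powr p - s $ i powr p)"
      using lam by (intro mult_left_mono) auto
    then have "lam * (?G \<bullet> (Z - X)) - 2 * (e / 3) * ?n \<le> lam * (\<Sum>i\<in>UNIV. ?sv Z $ i powr p - s $ i powr p)"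
      using lam by (simp add: right_diff_distrib)
    with f show ?case
      by (simp add: objective_def s inner_add_left sum_subtractf right_diff_distrib)
  qed
qed

section \<open>Soft thresholding of singular values\<close>
lemma svd_soft_threshold:
  assumes svd: "is_svd G U S V" and c: "mono (($) c)"
  shows "is_svd (U ** diag (\<chi> i. max 0 (S $ i - c $ i)) ** transpose V) U (\<chi> i. max 0 (S $ i - c $ i)) V"
proof -
  have "max 0 (S $ j - c $ j) \<le> max 0 (S $ i - c $ i)" if "i \<le> j" for i j
    using antimonoD[OF is_svdD(4)[OF svd] that] monoD[OF c that] by (intro max.mono) auto
  then show ?thesis using svd by (auto simp: is_svd_def intro!: antimonoI)
qed

text \<open>
  Mirsky's inequality bounds the squared distance of any competitor from below by that of the singular
  values, after which the problem splits into one scalar problem for each index.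
\<close>
lemma soft_threshold_minimizes:
  fixes G Z :: "('m::{finite,linorder}, 'n::finite) rmat"
  assumes dims: "CARD('m) \<le> CARD('n)" and svd: "is_svd G U S V" and c: "mono (($) c)"
    and x: "x = (\<chi> i. max 0 (S $ i - c $ i))"
  shows "(norm (U ** diag x ** transpose V - G))\<^sup>2 + 2 * (\<Sum>i\<in>UNIV. c $ i * x $ i)
    \<le> (norm (Z - G))\<^sup>2 + 2 * (\<Sum>i\<in>UNIV. c $ i * singular_values Z $ i)"
proof -
  obtain P Q where Z: "is_svd Z P (singular_values Z) Q" using singular_values_svd[OF dims] .
  let ?z = "singular_values Z"
  have sq: "(norm v)\<^sup>2 = (\<Sum>i\<in>UNIV. (v $ i)\<^sup>2)" for v :: "'m rvec"
    unfolding power2_norm_eq_inner inner_vec_def by (simp add: power2_eq_square)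
  have scalar: "(a - S $ i)\<^sup>2 + 2 * (c $ i * a) \<le> (z - S $ i)\<^sup>2 + 2 * (c $ i * z)"
    if "0 \<le> z" "a = max 0 (S $ i - c $ i)" for a z i
  proof (cases "c $ i \<le> S $ i")
    case True
    then have a: "a = S $ i - c $ i" using that(2) by simp
    have "0 \<le> (z - (S $ i - c $ i))\<^sup>2" by simp
    then show ?thesis unfolding a by (simp add: power2_eq_square algebra_simps)
  next
    case False
    then have a: "a = 0" using that(2) by simp
    have "0 \<le> z * z" "S $ i * z \<le> c $ i * z" using False that by (auto intro: mult_right_mono)
    moreover have "(z - S $ i)\<^sup>2 = z * z - 2 * (S $ i * z) + (S $ i)\<^sup>2"
      by (simp add: power2_eq_square algebra_simps)
    ultimately show ?thesis unfolding a by simp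
  qed
  have "(norm (U ** diag x ** transpose V - G))\<^sup>2 + 2 * (\<Sum>i\<in>UNIV. c $ i * x $ i)
      = (norm (x - S))\<^sup>2 + 2 * (\<Sum>i\<in>UNIV. c $ i * x $ i)"
    using norm_diag_sandwich[OF is_svdD(1,2)[OF svd], of "x - S"]
    unfolding diag_sandwich_linear is_svdD(5)[OF svd, symmetric] by simp
  also have "\<dots> = (\<Sum>i\<in>UNIV. (x $ i - S $ i)\<^sup>2 + 2 * (c $ i * x $ i))"
    by (simp add: sq sum.distrib sum_distrib_left)
  also have "\<dots> \<le> (\<Sum>i\<in>UNIV. (?z $ i - S $ i)\<^sup>2 + 2 * (c $ i * ?z $ i))"
    by (intro sum_mono scalar is_svdD(3)[OF Z]) (simp add: x)
  also have "\<dots> = (norm (?z - S))\<^sup>2 + 2 * (\<Sum>i\<in>UNIV. c $ i * ?z $ i)"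
    by (simp add: sq sum.distrib sum_distrib_left)
  also have "\<dots> \<le> (norm (Z - G))\<^sup>2 + 2 * (\<Sum>i\<in>UNIV. c $ i * ?z $ i)"
    using power_mono[OF svd_norm_diff_le[OF Z svd], of 2] by simp
  finally show ?thesis .
qed

lemma pos_idx_svd: "is_svd A U s V \<Longrightarrow> pos_idx A = {i. 0 < s $ i}"
  by (simp add: pos_idx_def singular_values_eq)

lemma zero_idx_eq:
  fixes A :: "('m::{finite,linorder}, 'n::finite) rmat"
  assumes "CARD('m) \<le> CARD('n)"
  shows "zero_idx A = - pos_idx A"
  using singular_values_nonneg[OF assms, of A] by (auto simp: zero_idx_def pos_idx_def less_le)

text \<open>
  The first order condition is diagonal in the bases \<open>U\<close> and \<open>V\<close>. It says \<open>c * \<xi> = S - x\<close> with the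
  threshold \<open>c\<close> and the thresholded spectrum \<open>x\<close>, and so determines \<open>\<xi>\<close>.
\<close>
lemma xi_vector_optimality:
  fixes U :: "('m::{finite,linorder}, 'm) rmat" and V :: "('n::finite, 'm) rmat"
  assumes "0 < beta" "0 < lam" and w: "\<And>i. 0 < w $ i" "mono (($) w)"
    and svd: "is_svd ((1 / 2) *\<^sub>R (X + Y) - (1 / (2 * beta)) *\<^sub>R gradf Y) U S V"
    and X': "X' = U ** diag (\<chi> i. max 0 (S $ i - lam * w $ i / (2 * beta))) ** transpose V"
  defines "\<xi> \<equiv> xi_vector gradf lam beta X Y X' w U V"
  shows "\<forall>i\<in>pos_idx X'. \<xi> $ i = 1"
    and "0 = gradf Y + beta *\<^sub>R (X' - Y) + beta *\<^sub>R (X' - X) + lam *\<^sub>R (U ** diag (w * \<xi>) ** transpose V)"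
proof -
  define c where "c = (\<chi> i. lam * w $ i / (2 * beta))"
  \<comment> \<open>The singular values of the new iterate.\<close>
  define x where "x = (\<chi> i. max 0 (S $ i - c $ i))"
  have c_pos: "0 < c $ i" for i using assms by (simp add: c_def)
  have "mono (($) c)"
    using monoD[OF w(2)] assms(1,2) by (auto simp: c_def intro!: monoI divide_right_mono)
  from svd_soft_threshold[OF svd this] have svd': "is_svd X' U x V"
    using X' by (simp add: x_def c_def)
  have pos: "i \<in> pos_idx X' \<longleftrightarrow> c $ i < S $ i" for i
    unfolding pos_idx_svd[OF svd'] by (auto simp: x_def)
  have zero: "i \<in> zero_idx X' \<longleftrightarrow> S $ i \<le> c $ i" for i
    unfolding zero_idx_def singular_values_eq[OF svd'] by (auto simp: x_def)
  let ?G = "(1 / 2) *\<^sub>R (X + Y) - (1 / (2 * beta)) *\<^sub>R gradf Y"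
  have gradient: "gradf Y + beta *\<^sub>R (X' - Y) + beta *\<^sub>R (X' - X) = (2 * beta) *\<^sub>R (X' - ?G)"
    using assms(1) by (simp add: algebra_simps scaleR_2[symmetric])
  have eq_iff: "0 = gradf Y + beta *\<^sub>R (X' - Y) + beta *\<^sub>R (X' - X) + lam *\<^sub>R (U ** diag (w * y) ** transpose V)
      \<longleftrightarrow> (\<forall>i. c $ i * y $ i = S $ i - x $ i)" for y
  proof -
    have "gradf Y + beta *\<^sub>R (X' - Y) + beta *\<^sub>R (X' - X) + lam *\<^sub>R (U ** diag (w * y) ** transpose V)
        = U ** diag ((2 * beta) *\<^sub>R (x - S) + lam *\<^sub>R (w * y)) ** transpose V"
      unfolding gradient
      unfolding diag_sandwich_linear is_svdD(5)[OF svd, symmetric] is_svdD(5)[OF svd', symmetric] ..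
    moreover have "U ** diag a ** transpose V = 0 \<longleftrightarrow> a = 0" for a
      using norm_diag_sandwich[OF is_svdD(1,2)[OF svd], of a] by (metis norm_eq_zero)
    moreover have "(2 * beta) *\<^sub>R (x - S) + lam *\<^sub>R (w * y) = 0 \<longleftrightarrow> (\<forall>i. c $ i * y $ i = S $ i - x $ i)"
      using assms(1) by (auto simp: vec_eq_iff c_def field_simps)
    ultimately show ?thesis by (simp only: eq_commute[of 0])
  qed
  let ?P = "\<lambda>y. (\<forall>i\<in>pos_idx X'. y $ i = 1) \<and> (\<forall>i\<in>zero_idx X'. - 1 \<le> y $ i \<and> y $ i \<le> 1) \<and>
    0 = gradf Y + beta *\<^sub>R (X' - Y) + beta *\<^sub>R (X' - X) + lam *\<^sub>R (U ** diag (w * y) ** transpose V)"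
  have "?P (\<chi> i. (S $ i - x $ i) / c $ i)"
    unfolding eq_iff
  proof (intro conjI ballI allI)
    fix i
    have c: "0 < c $ i" "0 \<le> S $ i" using c_pos is_svdD(3)[OF svd] by auto
    show "(\<chi> i. (S $ i - x $ i) / c $ i) $ i = 1" if "i \<in> pos_idx X'"
      using that c by (simp add: pos x_def max_def)
    show "- 1 \<le> (\<chi> i. (S $ i - x $ i) / c $ i) $ i" "(\<chi> i. (S $ i - x $ i) / c $ i) $ i \<le> 1"
      if "i \<in> zero_idx X'"
      using that c by (simp_all add: zero x_def max_def field_simps)
    show "c $ i * (\<chi> i. (S $ i - x $ i) / c $ i) $ i = S $ i - x $ i"
      using c by simp
  qed
  moreover have "y = (\<chi> i. (S $ i - x $ i) / c $ i)" if "?P y" for y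
  proof -
    have "c $ i * y $ i = S $ i - x $ i" for i using that unfolding eq_iff by blast
    then have "y $ i = (S $ i - x $ i) / c $ i" for i
      using c_pos[of i] by (simp add: nonzero_eq_divide_eq mult.commute)
    then show ?thesis by (simp add: vec_eq_iff)
  qed
  ultimately have "?P \<xi>"
    unfolding \<xi>_def xi_vector_def by (rule theI)
  then show "\<forall>i\<in>pos_idx X'. \<xi> $ i = 1"
    and "0 = gradf Y + beta *\<^sub>R (X' - Y) + beta *\<^sub>R (X' - X) + lam *\<^sub>R (U ** diag (w * \<xi>) ** transpose V)"
    by blast+
qed

section \<open>The update of the smoothing parameters\<close>
lemma pos_idx_down_closed:
  fixes A :: "('m::{finite,linorder}, 'n::finite) rmat"
  assumes "CARD('m) \<le> CARD('n)" "i \<in> pos_idx A" "j \<le> i"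
  shows "j \<in> pos_idx A"
  using antimonoD[OF singular_values_antimono[OF assms(1)] assms(3), of A] assms(2)
  by (simp add: pos_idx_def)

lemma entry_card_atMost:
  fixes i :: "'m::{finite,linorder}"
  shows "entry x (card {..i}) = x $ i"
proof -
  have "(THE j. card {..j} = card {..i}) = i"
  proof (rule the_equality)
    fix j :: 'm assume eq: "card {..j} = card {..i}"
    have "{..j} = {..i}"
      using eq linear[of i j] by (metis atMost_subset_iff card_subset_eq finite_code)
    then show "j = i" by simp
  qed simp
  then show ?thesis by (simp add: entry_def)
qed

lemma
  fixes P :: "'m::{finite,linorder} set"
  assumes down: "\<And>i j. i \<in> P \<Longrightarrow> j \<le> i \<Longrightarrow> j \<in> P"
  shows entry_last_inside: "P \<noteq> {} \<Longrightarrow> entry x (card P) = x $ Max P"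
    and entry_first_outside: "P \<noteq> UNIV \<Longrightarrow> entry x (card P + 1) = x $ Min (- P)"
proof -
  assume "P \<noteq> {}"
  then have "Max P \<in> P" by simp
  then have "x \<in> P \<longleftrightarrow> x \<le> Max P" for x
    using down[of "Max P" x] Max_ge[OF finite, of x P] by blast
  then have "P = {..Max P}" unfolding atMost_def by blast
  then show "entry x (card P) = x $ Max P" using entry_card_atMost[of x "Max P"] by simp
next
  assume "P \<noteq> UNIV"
  then have min: "Min (- P) \<in> - P" by (intro Min_in) auto
  have "x \<le> Min (- P) \<longleftrightarrow> x = Min (- P) \<or> x \<in> P" for x
  proof (cases "x \<in> P")
    case True
    then show ?thesis using min down[of x "Min (- P)"] linear[of x "Min (- P)"] by blast
  next
    case False
    then have "Min (- P) \<le> x" by (intro Min_le) auto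
    then show ?thesis using False by (metis order.antisym order_refl)
  qed
  then have "{..Min (- P)} = insert (Min (- P)) P" unfolding atMost_def by blast
  then have "card {..Min (- P)} = card P + 1" using min by simp
  then show "entry x (card P + 1) = x $ Min (- P)" using entry_card_atMost[of x "Min (- P)"] by simp
qed

lemma threshold_rule_cases:
  fixes X' :: "('m::{finite,linorder}, 'n::finite) rmat"
  assumes dims: "CARD('m) \<le> CARD('n)" and rule: "threshold_rule mu X' e e' i" and i: "i \<notin> pos_idx X'"
  defines "T \<equiv> singular_values X' $ Max (pos_idx X') + e' $ Max (pos_idx X')"
  shows "e' $ i = (if pos_idx X' = {} \<or> e $ Min (- pos_idx X') \<le> T then e $ i else min (e $ i) (mu * T))"
proof -
  have outside: "entry e (card (pos_idx X') + 1) = e $ Min (- pos_idx X')"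
    by (rule entry_first_outside, erule (1) pos_idx_down_closed[OF dims]) (use i in blast)
  show ?thesis
  proof (cases "pos_idx X' = {}")
    case True
    then show ?thesis using rule by (simp add: threshold_rule_def tau1_def)
  next
    case False
    then have "card (pos_idx X') \<noteq> 0" by simp
    moreover have "entry x (card (pos_idx X')) = x $ Max (pos_idx X')" for x
      by (rule entry_last_inside, erule (1) pos_idx_down_closed[OF dims]) (rule False)
    ultimately show ?thesis
      using rule outside False by (simp add: threshold_rule_def tau1_def T_def Let_def min_def split: if_splits)
  qed
qed

text \<open>
  The invariant of the smoothing update. The vector \<open>e\<close> is decreasing on the positive and on the zero
  indices separately, but not across the boundary, since only the positive indices are damped at each step.
  The sum with the singular values is decreasing throughout, which is what makes the weights increasing.
\<close>
definition admissible_smoothing :: "('m::{finite,linorder}, 'n::finite) rmat \<Rightarrow> 'm rvec \<Rightarrow> bool" where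
  "admissible_smoothing X e \<longleftrightarrow> (\<forall>i. 0 < e $ i) \<and>
     (\<forall>i j. i \<le> j \<longrightarrow> (i \<in> pos_idx X \<longleftrightarrow> j \<in> pos_idx X) \<longrightarrow> e $ j \<le> e $ i) \<and>
     antimono (\<lambda>i. singular_values X $ i + e $ i)"

text \<open>
  Across the boundary, monotonicity of the sum means that no smoothing value at a zero index exceeds the
  threshold \<open>T\<close>, the last positive entry of the sum. The threshold rule either caps the values by
  \<open>mu * T\<close>, or leaves them unchanged when the first of them, the largest that the rule applies to, is at most \<open>T\<close>.
\<close>
lemma eps_update_invariant:
  fixes X X' :: "('m::{finite,linorder}, 'n::finite) rmat"
  assumes dims: "CARD('m) \<le> CARD('n)" and mu: "0 < mu" "mu < 1"
    and adm: "admissible_smoothing X e" and update: "eps_update mu X X' e e'"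
  shows "admissible_smoothing X' e'" "\<And>i. e' $ i \<le> e $ i" "\<And>i. i \<in> pos_idx X' \<Longrightarrow> e' $ i \<le> mu * e $ i"
proof -
  define P where "P = pos_idx X"
  define P' where "P' = pos_idx X'"
  define T where "T = singular_values X' $ Max P' + e' $ Max P'"
  have e: "\<And>i. 0 < e $ i" "\<And>i j. i \<le> j \<Longrightarrow> (i \<in> P \<longleftrightarrow> j \<in> P) \<Longrightarrow> e $ j \<le> e $ i"
    using adm by (auto simp: admissible_smoothing_def P_def)
  note down = pos_idx_down_closed[OF dims, of _ X, folded P_def]
  note down' = pos_idx_down_closed[OF dims, of _ X', folded P'_def]
  have rule: "e' $ i = (if P' = {} \<or> e $ Min (- P') \<le> T then e $ i else min (e $ i) (mu * T))"
    if "threshold_rule mu X' e e' i" "i \<notin> P'" for i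
    using threshold_rule_cases[OF dims that(1)] that(2) by (simp add: P'_def T_def)
  have mu_e: "0 < mu * e $ i" "mu * e $ i \<le> e $ i" for i
    using mu e(1)[of i] by simp_all
  have sv': "0 \<le> singular_values X' $ i" for i using singular_values_nonneg[OF dims] .
  have Max': "Max P' \<in> P'" if "P' \<noteq> {}" using that by simp
  have Min': "Min (- P') \<notin> P'" "\<And>j. j \<notin> P' \<Longrightarrow> Min (- P') \<le> j" if "P' \<noteq> UNIV"
    using Min_in[of "- P'"] that by auto
  have T_pos: "0 < T" if "P' \<noteq> {}" "\<And>i. i \<in> P' \<Longrightarrow> 0 < e' $ i"
    using that(2)[OF Max'[OF that(1)]] sv'[of "Max P'"] by (simp add: T_def)
  have thr: "0 < e' $ i \<and> e' $ i \<le> e $ i \<and> (P' \<noteq> {} \<longrightarrow> e' $ i \<le> T)"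
    if "threshold_rule mu X' e e' i" "i \<notin> P'" "e $ i \<le> e $ Min (- P')" "P' \<noteq> {} \<Longrightarrow> 0 < T" for i
  proof (cases "P' = {}")
    case False
    then have "0 < mu * T" "mu * T \<le> T" using mu that(4) by simp_all
    then show ?thesis using rule[OF that(1,2)] that(3) e(1)[of i] by auto
  qed (use rule[OF that(1,2)] e(1)[of i] in simp)
  have thr_mono: "e' $ j \<le> e' $ i"
    if "threshold_rule mu X' e e' i" "i \<notin> P'" "threshold_rule mu X' e e' j" "j \<notin> P'" "e $ j \<le> e $ i" for i j
    using rule[OF that(1,2)] rule[OF that(3,4)] that(5) by auto
  consider (shrink) "P' \<subset> P" | (grow) "P \<subset> P'" | (same) "P = P'"
    using down down' by (metis linear psubsetI subsetI)
  then have main: "(\<forall>i. 0 < e' $ i) \<and> (\<forall>i. e' $ i \<le> e $ i) \<and> (\<forall>i\<in>P'. e' $ i \<le> mu * e $ i) \<and>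
      (\<forall>i j. i \<le> j \<longrightarrow> (i \<in> P' \<longleftrightarrow> j \<in> P') \<longrightarrow> e' $ j \<le> e' $ i) \<and>
      (P' \<noteq> {} \<longrightarrow> (\<forall>j. j \<notin> P' \<longrightarrow> e' $ j \<le> T))"
  proof cases
    case shrink
    then have "P \<noteq> {}" by auto
    define r where "r = Max P"
    have r: "r \<in> P" "\<And>i. i \<in> P \<Longrightarrow> i \<le> r" using \<open>P \<noteq> {}\<close> by (auto simp: r_def)
    have "r \<notin> P'" using shrink down' r(2) by blast
    have "entry e' (card P) = e' $ r"
      unfolding r_def by (rule entry_last_inside, erule (1) down) (rule \<open>P \<noteq> {}\<close>)
    then have u1: "\<And>i. i \<in> P' \<Longrightarrow> e' $ i = mu * e $ i"
      and u2: "\<And>i. i \<in> P \<Longrightarrow> i \<notin> P' \<Longrightarrow> threshold_rule mu X' e e' i"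
      and u3: "\<And>i. i \<notin> P \<Longrightarrow> e' $ i = min (e $ i) (e' $ r)"
      using update shrink \<open>P \<noteq> {}\<close>
      by (auto simp: eps_update_def zero_idx_eq[OF dims] P_def[symmetric] P'_def[symmetric] Let_def min_def split: if_splits)
    have q: "Min (- P') \<in> P" using Min'(2) \<open>r \<notin> P'\<close> down r(1) by blast
    have mid: "0 < e' $ i \<and> e' $ i \<le> e $ i \<and> (P' \<noteq> {} \<longrightarrow> e' $ i \<le> T)" if "i \<in> P" "i \<notin> P'" for i
      using that q Min'(2)[OF _ that(2)] u1 mu_e(1)
      by (intro thr u2 e(2) T_pos) auto
    have low: "0 < e' $ i \<and> e' $ i \<le> e $ i \<and> (P' \<noteq> {} \<longrightarrow> e' $ i \<le> T)" if "i \<notin> P" for i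
      using u3[OF that] e(1)[of i] mid[OF r(1) \<open>r \<notin> P'\<close>] by auto
    have mono: "e' $ j \<le> e' $ i" if ij: "i \<le> j" "i \<in> P' \<longleftrightarrow> j \<in> P'" for i j
    proof -
      consider "i \<in> P'" "j \<in> P'" | "i \<in> P" "j \<in> P" "i \<notin> P'" "j \<notin> P'" | "i \<in> P" "j \<notin> P" "i \<notin> P'" | "i \<notin> P" "j \<notin> P"
        using ij shrink down[of j i] by blast
      then show ?thesis
      proof cases
        case 1
        then show ?thesis using u1 e(2)[OF ij(1)] mu shrink by auto
      next
        case 2
        then show ?thesis using u2 e(2)[OF ij(1)] by (intro thr_mono) auto
      next
        case 3
        have "e' $ r \<le> e' $ i"
          using 3 u2 e(2)[OF r(2)[of i]] r(1) \<open>r \<notin> P'\<close> by (intro thr_mono) auto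
        then show ?thesis using u3[OF 3(2)] by simp
      next
        case 4
        then show ?thesis using u3[of i] u3[of j] e(2)[OF ij(1)] by auto
      qed
    qed
    have "0 < e' $ i \<and> e' $ i \<le> e $ i" for i
      using mid low u1[of i] mu_e[of i] by (cases "i \<in> P'"; cases "i \<in> P") auto
    then show ?thesis using mono mid low u1 by (metis order_refl)
  next
    case grow
    define r where "r = Max P"
    have "entry e (card P) = e $ r" if "P \<noteq> {}"
      unfolding r_def by (rule entry_last_inside, erule (1) down) (rule that)
    then have u1: "\<And>i. i \<in> P \<Longrightarrow> e' $ i = mu * e $ i"
      and u2: "\<And>i. i \<in> P' \<Longrightarrow> i \<notin> P \<Longrightarrow> e' $ i = mu * (if P = {} then e $ i else min (e $ i) (e $ r))"
      and u3: "\<And>i. i \<notin> P' \<Longrightarrow> threshold_rule mu X' e e' i"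
      using update grow
      by (auto simp: eps_update_def zero_idx_eq[OF dims] P_def[symmetric] P'_def[symmetric] Let_def min_def split: if_splits)
    have inside: "0 < e' $ i \<and> e' $ i \<le> mu * e $ i" if "i \<in> P'" for i
      using that u1[of i] u2[of i] mu_e(1)[of i] mu_e(1)[of r] mu(1) by (cases "i \<in> P") (auto simp: min_def)
    have outside: "0 < e' $ i \<and> e' $ i \<le> e $ i \<and> (P' \<noteq> {} \<longrightarrow> e' $ i \<le> T)" if "i \<notin> P'" for i
    proof -
      have "e $ i \<le> e $ Min (- P')" using that grow Min' by (intro e(2)) auto
      then show ?thesis using that inside by (intro thr u3 T_pos) auto
    qed
    have mono: "e' $ j \<le> e' $ i" if ij: "i \<le> j" "i \<in> P' \<longleftrightarrow> j \<in> P'" for i j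
    proof -
      consider "i \<in> P" "j \<in> P" | "i \<in> P" "j \<in> P'" "j \<notin> P" | "i \<notin> P" "j \<notin> P" "i \<in> P'" "j \<in> P'" | "i \<notin> P'" "j \<notin> P'"
        using ij grow down[of j i] by blast
      then show ?thesis
      proof cases
        case 1
        then show ?thesis using u1 e(2)[OF ij(1)] mu by auto
      next
        case 2
        then have "r \<in> P" unfolding r_def by (intro Max_in) auto
        then have "e $ r \<le> e $ i" using 2 by (intro e(2)) (auto simp: r_def)
        then have "min (e $ j) (e $ r) \<le> e $ i" by simp
        then show ?thesis using 2 u1[OF 2(1)] u2[OF 2(2,3)] mu by auto
      next
        case 3
        have "e $ j \<le> e $ i" using 3 e(2)[OF ij(1)] by simp
        then have "(if P = {} then e $ j else min (e $ j) (e $ r)) \<le> (if P = {} then e $ i else min (e $ i) (e $ r))"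
          by auto
        then show ?thesis unfolding u2[OF 3(3,1)] u2[OF 3(4,2)] using mu by (intro mult_left_mono) auto
      next
        case 4
        then have "i \<notin> P" "j \<notin> P" using grow by auto
        then show ?thesis using 4 u3 e(2)[OF ij(1)] by (intro thr_mono) auto
      qed
    qed
    have "0 < e' $ i \<and> e' $ i \<le> e $ i" for i
      using inside[of i] outside[of i] mu_e(2)[of i] by (cases "i \<in> P'") auto
    then show ?thesis using mono inside outside by metis
  next
    case same
    then have u1: "\<And>i. i \<in> P' \<Longrightarrow> e' $ i = mu * e $ i"
      and u3: "\<And>i. i \<notin> P' \<Longrightarrow> threshold_rule mu X' e e' i"
      using update by (auto simp: eps_update_def zero_idx_eq[OF dims] P_def[symmetric] P'_def[symmetric])
    have outside: "0 < e' $ i \<and> e' $ i \<le> e $ i \<and> (P' \<noteq> {} \<longrightarrow> e' $ i \<le> T)" if "i \<notin> P'" for i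
    proof -
      have "e $ i \<le> e $ Min (- P')" using that same Min' by (intro e(2)) auto
      then show ?thesis using that u1 mu_e(1) by (intro thr u3 T_pos) auto
    qed
    have mono: "e' $ j \<le> e' $ i" if ij: "i \<le> j" "i \<in> P' \<longleftrightarrow> j \<in> P'" for i j
    proof (cases "i \<in> P'")
      case True
      then show ?thesis using ij u1 e(2)[OF ij(1)] same mu by auto
    next
      case False
      then show ?thesis using ij u3 e(2)[OF ij(1)] same by (intro thr_mono) auto
    qed
    have "0 < e' $ i \<and> e' $ i \<le> e $ i" for i
      using u1[of i] outside[of i] mu_e[of i] by (cases "i \<in> P'") auto
    then show ?thesis using mono u1 outside by (metis order_refl)
  qed
  have "singular_values X' $ j + e' $ j \<le> singular_values X' $ i + e' $ i" if "i \<le> j" for i j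
  proof -
    have sv_mono: "singular_values X' $ b \<le> singular_values X' $ a" if "a \<le> b" for a b
      using antimonoD[OF singular_values_antimono[OF dims] that] .
    show ?thesis
    proof (cases "i \<in> P' \<longleftrightarrow> j \<in> P'")
      case True
      then show ?thesis using main sv_mono[OF that] that by (meson add_mono)
    next
      case False
      then have ij: "i \<in> P'" "j \<notin> P'" using down'[of j i] that by auto
      then have "P' \<noteq> {}" by auto
      have "singular_values X' $ j = 0" using ij(2) sv'[of j] by (simp add: P'_def pos_idx_def)
      then have "singular_values X' $ j + e' $ j \<le> T" using main ij(2) \<open>P' \<noteq> {}\<close> by simp
      also have "T \<le> singular_values X' $ i + e' $ i"
        using main sv_mono[of i "Max P'"] ij(1) Max'[OF \<open>P' \<noteq> {}\<close>] Max_ge[of P' i]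
        unfolding T_def by (intro add_mono) auto
      finally show ?thesis .
    qed
  qed
  then show "admissible_smoothing X' e'" "\<And>i. e' $ i \<le> e $ i" "\<And>i. i \<in> pos_idx X' \<Longrightarrow> e' $ i \<le> mu * e $ i"
    using main by (auto simp: admissible_smoothing_def P'_def intro!: antimonoI)
qed

section \<open>First order bounds for smooth functions and powers\<close>
text \<open>
  Along the segment from \<open>x\<close> to \<open>y\<close>, the difference of the two sides has a derivative of constant sign.
\<close>
lemma lipschitz_gradient_upper_bound:
  fixes f :: "'a::real_inner \<Rightarrow> real"
  assumes grad: "\<And>x. GDERIV f x :> g x" and lip: "L-lipschitz_on UNIV g"
  shows "f y \<le> f x + g x \<bullet> (y - x) + L / 2 * (norm (y - x))\<^sup>2"
proof -
  define d where "d = y - x"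
  define h where "h t = f (x + t *\<^sub>R d) - t * (g x \<bullet> d) - L / 2 * t\<^sup>2 * (norm d)\<^sup>2" for t
  have "h 1 \<le> h 0"
  proof (rule DERIV_nonpos_imp_nonincreasing[of 0 1 h])
    fix t :: real assume t: "0 \<le> t" "t \<le> 1"
    have "((\<lambda>t. f (x + t *\<^sub>R d)) has_derivative (\<lambda>s. (s *\<^sub>R d) \<bullet> g (x + t *\<^sub>R d))) (at t)"
      by (rule has_derivative_compose[of _ "\<lambda>s. s *\<^sub>R d" t UNIV f])
         (use grad[of "x + t *\<^sub>R d"] in \<open>auto simp: gderiv_def intro!: derivative_eq_intros\<close>)
    moreover have "(\<lambda>s. (s *\<^sub>R d) \<bullet> g (x + t *\<^sub>R d)) = (*) (g (x + t *\<^sub>R d) \<bullet> d)"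
      by (simp add: fun_eq_iff inner_commute)
    ultimately have "((\<lambda>t. f (x + t *\<^sub>R d)) has_real_derivative (g (x + t *\<^sub>R d) \<bullet> d)) (at t)"
      by (simp add: has_field_derivative_def)
    then have "(h has_real_derivative (g (x + t *\<^sub>R d) \<bullet> d - g x \<bullet> d - L * t * (norm d)\<^sup>2)) (at t)"
      unfolding h_def by (auto intro!: derivative_eq_intros)
    moreover have "g (x + t *\<^sub>R d) \<bullet> d - g x \<bullet> d \<le> L * t * (norm d)\<^sup>2"
    proof -
      have "g (x + t *\<^sub>R d) \<bullet> d - g x \<bullet> d \<le> norm (g (x + t *\<^sub>R d) - g x) * norm d"
        unfolding inner_diff_left[symmetric] by (rule norm_cauchy_schwarz)
      also have "\<dots> \<le> L * norm (t *\<^sub>R d) * norm d"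
        using lipschitz_onD[OF lip, of "x + t *\<^sub>R d" x] by (intro mult_right_mono) (auto simp: dist_norm)
      finally show ?thesis using t by (simp add: power2_eq_square mult.assoc)
    qed
    ultimately show "\<exists>z. (h has_real_derivative z) (at t) \<and> z \<le> 0" by force
  qed simp
  then show ?thesis by (simp add: h_def d_def)
qed

lemma lipschitz_gradient_lower_bound:
  fixes f :: "'a::real_inner \<Rightarrow> real"
  assumes grad: "\<And>x. GDERIV f x :> g x" and lip: "L-lipschitz_on UNIV g"
  shows "f x + g x \<bullet> (y - x) - L / 2 * (norm (y - x))\<^sup>2 \<le> f y"
proof -
  have "GDERIV (\<lambda>x. - f x) x :> - g x" for x using grad by (rule GDERIV_minus)
  moreover have "L-lipschitz_on UNIV (\<lambda>x. - g x)" using lip by simp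
  ultimately show ?thesis
    using lipschitz_gradient_upper_bound[of "\<lambda>x. - f x" "\<lambda>x. - g x" L y x] by simp
qed

lemma convex_above_gradient_tangent:
  fixes f :: "'a::real_inner \<Rightarrow> real"
  assumes conv: "convex_on UNIV f" and grad: "GDERIV f x :> g"
  shows "f x + g \<bullet> (y - x) \<le> f y"
proof -
  define d where "d = y - x"
  have "convex_on UNIV (\<lambda>t. f (x + t *\<^sub>R d))"
  proof (rule convex_onI)
    fix t a b :: real assume t: "0 < t" "t < 1"
    have "x + ((1 - t) *\<^sub>R a + t *\<^sub>R b) *\<^sub>R d = (1 - t) *\<^sub>R (x + a *\<^sub>R d) + t *\<^sub>R (x + b *\<^sub>R d)"
      by (simp add: algebra_simps)
    then show "f (x + ((1 - t) *\<^sub>R a + t *\<^sub>R b) *\<^sub>R d) \<le> (1 - t) * f (x + a *\<^sub>R d) + t * f (x + b *\<^sub>R d)"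
      using convex_onD[OF conv, of t "x + a *\<^sub>R d" "x + b *\<^sub>R d"] t by simp
  qed simp
  moreover have "((\<lambda>t. f (x + t *\<^sub>R d)) has_real_derivative (g \<bullet> d)) (at 0)"
  proof -
    have "((\<lambda>t. f (x + t *\<^sub>R d)) has_derivative (\<lambda>s. (s *\<^sub>R d) \<bullet> g)) (at 0)"
    by (rule has_derivative_compose[of _ "\<lambda>s. s *\<^sub>R d" 0 UNIV f])
       (use grad in \<open>auto simp: gderiv_def intro!: derivative_eq_intros\<close>)
    moreover have "(\<lambda>s. (s *\<^sub>R d) \<bullet> g) = (*) (g \<bullet> d)"
      by (simp add: fun_eq_iff inner_commute)
    ultimately show ?thesis by (simp add: has_field_derivative_def)
  qed
  ultimately have "f (x + 1 *\<^sub>R d) - f (x + 0 *\<^sub>R d) \<ge> (g \<bullet> d) * (1 - 0)"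
    by (intro convex_on_imp_above_tangent[where A = UNIV and f = "\<lambda>t. f (x + t *\<^sub>R d)"]) auto
  then show ?thesis by (simp add: d_def)
qed

text \<open>
  Concavity of the power, in the form of Young's inequality for \<open>a\<close> and \<open>b\<close>. The point \<open>a\<close> may be 0.
\<close>
lemma powr_below_tangent:
  fixes a b p :: real
  assumes "0 \<le> a" "0 < b" "0 < p" "p < 1"
  shows "a powr p \<le> b powr p + p * b powr (p - 1) * (a - b)"
proof (cases "a = 0")
  case True
  have "p * b powr (p - 1) * (a - b) = - (p * b powr p)" using True assms by (simp add: powr_diff)
  moreover have "p * b powr p \<le> b powr p" using assms by simp
  ultimately have "0 \<le> b powr p + p * b powr (p - 1) * (a - b)" by linarith
  then show ?thesis using True by simp
next
  case False
  have "a powr p * b powr (1 - p) * b powr (p - 1) \<le> (p * a + (1 - p) * b) * b powr (p - 1)"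
    using assms False by (intro mult_right_mono Youngs_inequality_0) auto
  also have "a powr p * b powr (1 - p) * b powr (p - 1) = a powr p"
    using assms by (simp add: mult.assoc powr_add[symmetric])
  also have "(p * a + (1 - p) * b) * b powr (p - 1) = b powr (p - 1) * b + p * b powr (p - 1) * (a - b)"
    by (simp add: algebra_simps)
  also have "b powr (p - 1) * b = b powr p" using assms by (simp add: powr_diff)
  finally show ?thesis .
qed

lemma powr_subadditive:
  fixes a b p :: real
  assumes "0 \<le> a" "0 \<le> b" "0 < p" "p \<le> 1"
  shows "(a + b) powr p \<le> a powr p + b powr p"
proof (cases "a = 0 \<or> b = 0")
  case False
  then have pos: "0 < a" "0 < b" using assms by auto
  have split: "x powr p = x powr (p - 1) * x" if "0 < x" for x
    using that by (simp add: powr_diff)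
  have "(a + b) powr p = (a + b) powr (p - 1) * a + (a + b) powr (p - 1) * b"
    using pos split[of "a + b"] by (simp add: distrib_left)
  also have "\<dots> \<le> a powr (p - 1) * a + b powr (p - 1) * b"
    using pos assms by (intro add_mono mult_right_mono powr_mono2') auto
  also have "\<dots> = a powr p + b powr p" using pos split by simp
  finally show ?thesis .
qed (use assms in auto)

lemma powr_lipschitz_away_from_zero:
  fixes a m x y :: real
  assumes "a \<le> 1" "0 < m" "m \<le> x" "m \<le> y"
  shows "\<bar>x powr a - y powr a\<bar> \<le> \<bar>a\<bar> * m powr (a - 1) * \<bar>x - y\<bar>"
proof -
  have "norm (x powr a - y powr a) \<le> (\<bar>a\<bar> * m powr (a - 1)) * norm (x - y)"
  proof (rule field_differentiable_bound[of "{m..}" _ "\<lambda>z. a * z powr (a - 1)"])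
    fix z assume z: "z \<in> {m..}"
    then show "((\<lambda>z. z powr a) has_real_derivative a * z powr (a - 1)) (at z within {m..})"
      using assms by (auto intro!: derivative_eq_intros)
    have "z powr (a - 1) \<le> m powr (a - 1)" using z assms by (intro powr_mono2') auto
    then show "norm (a * z powr (a - 1)) \<le> \<bar>a\<bar> * m powr (a - 1)"
      by (simp add: abs_mult mult_left_mono)
  qed (use assms in auto)
  then show ?thesis by simp
qed

section \<open>Cluster points of sequences with vanishing steps\<close>
lemma cluster_points_iff:
  fixes X :: "nat \<Rightarrow> 'a::metric_space"
  shows "l \<in> cluster_points X \<longleftrightarrow> (\<forall>e>0. \<forall>N. \<exists>n\<ge>N. dist (X n) l < e)"
proof
  assume "l \<in> cluster_points X"
  then obtain r where r: "strict_mono r" "(X \<circ> r) \<longlonglongrightarrow> l" by (auto simp: cluster_points_def)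
  show "\<forall>e>0. \<forall>N. \<exists>n\<ge>N. dist (X n) l < e"
  proof (intro allI impI)
    fix e :: real and N assume "0 < e"
    then obtain M where "\<And>n. n \<ge> M \<Longrightarrow> dist (X (r n)) l < e"
      using r(2) by (auto simp: lim_sequentially)
    then have "dist (X (r (max M N))) l < e" by simp
    moreover have "N \<le> r (max M N)" using seq_suble[OF r(1), of "max M N"] by simp
    ultimately show "\<exists>n\<ge>N. dist (X n) l < e" by blast
  qed
next
  assume near: "\<forall>e>0. \<forall>N. \<exists>n\<ge>N. dist (X n) l < e"
  have "\<exists>r. \<forall>k. dist (X (r k)) l < 1 / Suc k \<and> r k < r (Suc k)"
  proof (rule dependent_nat_choice)
    show "\<exists>n. dist (X n) l < 1 / Suc 0" using near[rule_format, of 1 0] by auto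
    fix n k
    have "0 < 1 / real (Suc (Suc k))" by simp
    from near[rule_format, OF this, of "Suc n"]
    show "\<exists>m. dist (X m) l < 1 / Suc (Suc k) \<and> n < m" by (auto simp: Suc_le_eq)
  qed
  then obtain r where r: "\<And>k. dist (X (r k)) l < 1 / Suc k" "\<And>k. r k < r (Suc k)" by blast
  have "(\<lambda>k. dist (X (r k)) l) \<longlonglongrightarrow> 0"
    by (rule tendsto_sandwich[OF _ _ tendsto_const LIMSEQ_inverse_real_of_nat])
       (use r(1) in \<open>auto simp: inverse_eq_divide less_imp_le\<close>)
  then have "(X \<circ> r) \<longlonglongrightarrow> l" unfolding tendsto_dist_iff[of "X \<circ> r"] by (simp add: o_def)
  then show "l \<in> cluster_points X" using r(2) by (auto simp: cluster_points_def strict_mono_Suc_iff)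
qed

lemma closed_cluster_points:
  fixes X :: "nat \<Rightarrow> 'a::metric_space"
  shows "closed (cluster_points X)"
proof -
  have "l \<in> cluster_points X" if l: "l \<in> closure (cluster_points X)" for l
    unfolding cluster_points_iff
  proof (intro allI impI)
    fix e :: real and N assume "0 < e"
    then obtain l' where l': "l' \<in> cluster_points X" "dist l' l < e / 2"
      using l unfolding closure_approachable by (metis half_gt_zero)
    then obtain n where "n \<ge> N" "dist (X n) l' < e / 2"
      using \<open>0 < e\<close> unfolding cluster_points_iff by (metis half_gt_zero)
    moreover have "dist (X n) l \<le> dist (X n) l' + dist l' l" by (rule dist_triangle)
    ultimately show "\<exists>n\<ge>N. dist (X n) l < e" using l'(2) by (intro exI[of _ n]) auto
  qed
  then show ?thesis unfolding closure_subset_eq[symmetric] by blast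
qed

lemma compact_cluster_points:
  fixes X :: "nat \<Rightarrow> 'a::heine_borel"
  assumes "bounded (range X)"
  shows "compact (cluster_points X)"
proof -
  have "cluster_points X \<subseteq> closure (range X)"
  proof
    fix l assume "l \<in> cluster_points X"
    then show "l \<in> closure (range X)" unfolding cluster_points_iff closure_approachable by blast
  qed
  then show ?thesis
    using assms closed_cluster_points[of X] bounded_subset[OF bounded_closure]
    by (auto simp: compact_eq_bounded_closed)
qed

text \<open>
  Otherwise infinitely many terms stay outside of \<open>W\<close>, and they have a cluster point of their own.
\<close>
lemma eventually_near_cluster_points:
  fixes X :: "nat \<Rightarrow> 'a::heine_borel"
  assumes "bounded (range X)" "open W" "cluster_points X \<subseteq> W"
  shows "\<forall>\<^sub>F n in sequentially. X n \<in> W"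
proof (rule ccontr)
  assume "\<not> ?thesis"
  then have "infinite {n. X n \<notin> W}"
    by (auto simp: eventually_cofinite cofinite_eq_sequentially[symmetric])
  then obtain r where r: "strict_mono r" "\<And>n::nat. X (r n) \<notin> W"
    using infinite_enumerate by blast
  have "bounded (range (X \<circ> r))" using assms(1) by (rule bounded_subset) auto
  then obtain l q where q: "strict_mono q" "((X \<circ> r) \<circ> q) \<longlonglongrightarrow> l"
    using bounded_imp_convergent_subsequence[OF \<open>bounded (range (X \<circ> r))\<close>] by blast
  then have "l \<in> cluster_points X"
    using strict_mono_o[OF r(1) q(1)] by (auto simp: cluster_points_def o_assoc)
  moreover have "l \<in> - W"
    using closed_sequentially[of "- W" "(X \<circ> r) \<circ> q" l] assms(2) r(2) q(2) by (auto simp: closed_open)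
  ultimately show False using assms(3) by blast
qed

lemma cluster_points_nonempty:
  fixes X :: "nat \<Rightarrow> 'a::heine_borel"
  assumes "bounded (range X)"
  shows "cluster_points X \<noteq> {}"
  using bounded_imp_convergent_subsequence[OF assms] unfolding cluster_points_def by blast

text \<open>
  If the cluster points split into two closed parts, these have a positive distance \<open>d\<close>. Late terms are
  close to one of the parts, and steps shorter than \<open>d / 4\<close> cannot change the part, although both are visited
  infinitely often.
\<close>
lemma connected_cluster_points:
  fixes X :: "nat \<Rightarrow> 'a::heine_borel"
  assumes bdd: "bounded (range X)" and step: "(\<lambda>n. dist (X (Suc n)) (X n)) \<longlonglongrightarrow> 0"
  shows "connected (cluster_points X)"
proof (rule ccontr)
  assume "\<not> connected (cluster_points X)"
  then have "\<exists>A B. closed A \<and> closed B \<and> A \<noteq> {} \<and> B \<noteq> {} \<and> A \<union> B = cluster_points X \<and> A \<inter> B = {}"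
    unfolding connected_closed_set[OF closed_cluster_points] by (rule notnotD)
  then obtain A B where AB: "closed A" "closed B" "A \<noteq> {}" "B \<noteq> {}" "A \<union> B = cluster_points X" "A \<inter> B = {}"
    by (elim exE conjE)
  have "compact A"
  proof -
    have "cluster_points X \<inter> A = A" using AB(5) by blast
    then show ?thesis using compact_Int_closed[OF compact_cluster_points[OF bdd] AB(1)] by simp
  qed
  then obtain d where d: "0 < d" "\<And>a b. a \<in> A \<Longrightarrow> b \<in> B \<Longrightarrow> d \<le> dist a b"
    using separate_compact_closed[OF _ AB(2,6)] by blast
  define near where "near C n \<longleftrightarrow> (\<exists>c\<in>C. dist c (X n) < d / 4)" for C n
  have "\<forall>\<^sub>F n in sequentially. X n \<in> (\<Union>c\<in>A \<union> B. ball c (d / 4))"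
    using d(1) AB(5) by (intro eventually_near_cluster_points[OF bdd]) auto
  moreover have "\<forall>\<^sub>F n in sequentially. dist (X (Suc n)) (X n) < d / 4"
    using order_tendstoD(2)[OF step, of "d / 4"] d(1) by simp
  ultimately have "\<forall>\<^sub>F n in sequentially. (near A n \<or> near B n) \<and> dist (X (Suc n)) (X n) < d / 4"
    by eventually_elim (auto simp: near_def)
  then obtain N where N: "\<And>n. n \<ge> N \<Longrightarrow> near A n \<or> near B n" "\<And>n. n \<ge> N \<Longrightarrow> dist (X (Suc n)) (X n) < d / 4"
    unfolding eventually_sequentially by blast
  have apart: "\<not> near B m" if nm: "near A n" "dist (X m) (X n) < d / 4" for m n
  proof
    assume "near B m"
    then obtain a b where ab: "a \<in> A" "dist a (X n) < d / 4" "b \<in> B" "dist b (X m) < d / 4"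
      using nm(1) unfolding near_def by blast
    have "dist a b \<le> dist a (X n) + dist (X n) (X m) + dist (X m) b"
      by (metis add.commute add_left_mono dist_triangle order_trans add.assoc)
    then show False using ab nm(2) d(1) d(2)[OF ab(1,3)] by (simp add: dist_commute)
  qed
  have visits: "\<exists>n\<ge>M. near C n" if "c \<in> C" "C \<subseteq> cluster_points X" for c C M
  proof -
    have "c \<in> cluster_points X" using that by blast
    then obtain n where "n \<ge> M" "dist (X n) c < d / 4"
      using d(1) unfolding cluster_points_iff by (meson divide_pos_pos zero_less_numeral)
    then show ?thesis using that(1) by (auto simp: near_def dist_commute)
  qed
  obtain a where "a \<in> A" using AB by blast
  then obtain n0 where n0: "n0 \<ge> N" "near A n0" using visits[of a A N] AB(5) by blast
  have "near A n" if "n \<ge> n0" for n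
    using that
  proof (induction n rule: dec_induct)
    case base
    show ?case by (rule n0(2))
  next
    case (step n)
    then have "\<not> near B (Suc n)" using apart[of n "Suc n"] N(2)[of n] n0(1) by simp
    then show ?case using N(1)[of "Suc n"] step n0(1) by auto
  qed
  moreover obtain b where "b \<in> B" using AB by blast
  then obtain m where "m \<ge> n0" "near B m" using visits[of b B n0] AB(5) by blast
  ultimately show False using apart[of m m] d(1) by auto
qed

section \<open>Descent along the iteration\<close>
text \<open>
  Completing the square in the subproblem, seen from the current iterate: \<open>z\<close> is the displacement,
  \<open>y\<close> the extrapolation and \<open>q\<close> the minimiser of the smooth part.
\<close>
lemma gradient_step_completion:
  fixes g y z :: "'a::real_inner"
  assumes "0 < beta" and q: "q = (1 / 2) *\<^sub>R y - (1 / (2 * beta)) *\<^sub>R g"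
  shows "beta * ((norm (z - q))\<^sup>2 - (norm q)\<^sup>2)
    = g \<bullet> z + beta / 2 * (norm (z - y))\<^sup>2 + beta / 2 * (norm z)\<^sup>2 - beta / 2 * (norm y)\<^sup>2"
proof -
  have 1: "(norm (z - q))\<^sup>2 - (norm q)\<^sup>2 = z \<bullet> z - 2 * (z \<bullet> q)"
    unfolding power2_norm_eq_inner by (simp add: inner_diff_left inner_diff_right inner_commute)
  have 2: "beta * (2 * (z \<bullet> q)) = beta * (z \<bullet> y) - g \<bullet> z"
    using assms(1) by (simp add: q inner_diff_right field_simps inner_commute)
  have 3: "(norm (z - y))\<^sup>2 = z \<bullet> z - 2 * (z \<bullet> y) + y \<bullet> y"
    unfolding power2_norm_eq_inner by (simp add: inner_diff_left inner_diff_right inner_commute)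
  have "beta * (z \<bullet> z - 2 * (z \<bullet> q)) = g \<bullet> z + beta / 2 * (z \<bullet> z - 2 * (z \<bullet> y) + y \<bullet> y)
      + beta / 2 * (z \<bullet> z) - beta / 2 * (y \<bullet> y)"
    unfolding right_diff_distrib 2 by (simp add: algebra_simps)
  then show ?thesis
    unfolding 1 3 power2_norm_eq_inner[of z] power2_norm_eq_inner[of y] .
qed

text \<open>
  One run of the algorithm, so that the derived quantities of an iteration have names.
\<close>
locale eirnri =
  fixes f :: "('m::{finite,linorder}, 'n::finite) rmat \<Rightarrow> real"
    and gradf :: "('m, 'n) rmat \<Rightarrow> ('m, 'n) rmat"
    and L lam p beta mu alpha_bar :: real
    and alpha :: "nat \<Rightarrow> real"
    and X :: "nat \<Rightarrow> ('m, 'n) rmat"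
    and eps S :: "nat \<Rightarrow> 'm rvec"
    and U :: "nat \<Rightarrow> ('m, 'm) rmat"
    and V :: "nat \<Rightarrow> ('n, 'm) rmat"
  assumes dims: "CARD('m) \<le> CARD('n)"
    and p: "0 < p" "p < 1"
    and lam: "lam > 0"
    and grad: "\<And>Z. GDERIV f Z :> gradf Z"
    and lipschitz: "L-lipschitz_on UNIV gradf"
    and level_bounded: "filterlim (objective f lam p) at_top at_infinity"
    and algorithm: "EIRNRI f gradf L lam p beta mu alpha_bar alpha X eps U S V"
begin

definition Y :: "nat \<Rightarrow> ('m, 'n) rmat" where
  "Y = extrapolated alpha X"

definition w :: "nat \<Rightarrow> 'm rvec" where
  "w k = weights p (X k) (eps k)"

definition target :: "nat \<Rightarrow> ('m, 'n) rmat" where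
  "target k = (1 / 2) *\<^sub>R (X k + Y k) - (1 / (2 * beta)) *\<^sub>R gradf (Y k)"

definition step :: "nat \<Rightarrow> real" where
  "step k = norm (X k - X (k - 1))"

abbreviation sv :: "nat \<Rightarrow> 'm \<Rightarrow> real" where
  "sv k i \<equiv> singular_values (X k) $ i"

definition smoothed :: "nat \<Rightarrow> real" where
  "smoothed k = f (X k) + lam * (\<Sum>i\<in>UNIV. (sv k i + eps k $ i) powr p)"

lemma
  shows L_nonneg: "0 \<le> L" and beta: "L < beta" "0 < beta" and mu: "0 < mu" "mu < 1"
    and alpha: "0 \<le> alpha k" "alpha k \<le> alpha_bar"
  using algorithm lipschitz_on_nonneg[OF lipschitz] by (auto simp: EIRNRI_def)

lemma
  shows svd_target: "is_svd (target k) (U (Suc k)) (S (Suc k)) (V (Suc k))"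
    and X_Suc: "X (Suc k) = U (Suc k) ** diag (\<chi> i. max 0 (S (Suc k) $ i - lam * w k $ i / (2 * beta)))
            ** transpose (V (Suc k))"
    and eps_Suc: "eps_update mu (X k) (X (Suc k)) (eps k) (eps (Suc k))"
  using algorithm unfolding EIRNRI_def Let_def w_def Y_def target_def by blast+

lemma alpha_bar_cases:
  "0 < alpha_bar" "convex_on UNIV f \<Longrightarrow> alpha_bar < 1"
  "\<not> convex_on UNIV f \<Longrightarrow> alpha_bar < sqrt (beta / (beta + 3 * L))"
  using algorithm by (auto simp: EIRNRI_def Let_def)

lemma alpha_bar_sq_nonconvex: "\<not> convex_on UNIV f \<Longrightarrow> alpha_bar\<^sup>2 * (beta + 3 * L) < beta"
proof -
  assume "\<not> convex_on UNIV f"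
  then have "alpha_bar\<^sup>2 < (sqrt (beta / (beta + 3 * L)))\<^sup>2"
    using alpha_bar_cases by (intro power_strict_mono) auto
  also have "\<dots> = beta / (beta + 3 * L)" using beta L_nonneg by simp
  finally show ?thesis using beta L_nonneg by (simp add: pos_less_divide_eq)
qed

lemma alpha_le_1: "alpha k \<le> 1"
proof (cases "convex_on UNIV f")
  case False
  have "alpha_bar\<^sup>2 * (beta + 3 * L) < 1 * (beta + 3 * L)"
    using alpha_bar_sq_nonconvex[OF False] L_nonneg by simp
  then have "alpha_bar\<^sup>2 < 1\<^sup>2" using beta L_nonneg by (simp add: mult_less_cancel_right)
  then have "alpha_bar < 1" by (rule power_less_imp_less_base) simp
  then show ?thesis using alpha(2)[of k] by simp
qed (use alpha_bar_cases(2) alpha(2)[of k] in simp)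

lemma norm_Y_diff: "norm (Y k - X k) = alpha k * step k"
  using alpha(1)[of k] by (simp add: Y_def extrapolated_def step_def)

lemma norm_Y_diff_le: "norm (Y k - X k) \<le> step k"
  unfolding norm_Y_diff using alpha(1) alpha_le_1[of k] by (simp add: step_def mult_left_le_one_le)

lemma step_nonneg: "0 \<le> step k" by (simp add: step_def)

lemma step_Suc: "step (Suc k) = norm (X (Suc k) - X k)" by (simp add: step_def)

lemma admissible: "admissible_smoothing (X k) (eps k)"
proof (induction k)
  case 0
  have e0: "\<forall>i. 0 < eps 0 $ i" "antimono (($) (eps 0))"
    using algorithm by (auto simp: EIRNRI_def)
  then show ?case
    using antimonoD[OF e0(2)] antimonoD[OF singular_values_antimono[OF dims]]
    by (auto simp: admissible_smoothing_def intro!: antimonoI add_mono)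
next
  case (Suc k)
  show ?case by (rule eps_update_invariant(1)[OF dims mu Suc eps_Suc])
qed

lemma eps_pos: "0 < eps k $ i"
  using admissible[of k] by (simp add: admissible_smoothing_def)

lemma eps_Suc_le: "eps (Suc k) $ i \<le> eps k $ i"
  and eps_shrinks: "i \<in> pos_idx (X (Suc k)) \<Longrightarrow> eps (Suc k) $ i \<le> mu * eps k $ i"
  by (rule eps_update_invariant(2,3)[OF dims mu admissible eps_Suc])+

lemma sv_nonneg: "0 \<le> sv k i" by (rule singular_values_nonneg[OF dims])

lemma sv_eps_pos: "0 < sv k i + eps k $ i"
  using eps_pos[of k i] sv_nonneg[of k i] by simp

lemma w_pos: "0 < w k $ i" and w_mono: "mono (($) (w k))"
proof -
  show "0 < w k $ i" using sv_eps_pos[of k i] p by (simp add: w_def weights_def)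
  show "mono (($) (w k))"
  proof (rule monoI)
    fix i j :: 'm assume "i \<le> j"
    then have "sv k j + eps k $ j \<le> sv k i + eps k $ i"
      using admissible[of k] by (auto simp: admissible_smoothing_def dest: antimonoD)
    then show "w k $ i \<le> w k $ j"
      using sv_eps_pos[of k j] p by (auto simp: w_def weights_def intro!: mult_left_mono powr_mono2')
  qed
qed

lemma threshold_mono: "mono (($) (\<chi> i. lam * w k $ i / (2 * beta)))"
  using monoD[OF w_mono] lam beta by (auto intro!: monoI divide_right_mono mult_left_mono)

lemma sv_Suc: "singular_values (X (Suc k)) = (\<chi> i. max 0 (S (Suc k) $ i - lam * w k $ i / (2 * beta)))"
  and svd_X_Suc: "is_svd (X (Suc k)) (U (Suc k)) (singular_values (X (Suc k))) (V (Suc k))"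
proof -
  have "is_svd (X (Suc k)) (U (Suc k)) (\<chi> i. max 0 (S (Suc k) $ i - lam * w k $ i / (2 * beta))) (V (Suc k))"
    using svd_soft_threshold[OF svd_target threshold_mono, of k] by (simp add: X_Suc)
  moreover from this show "singular_values (X (Suc k)) = (\<chi> i. max 0 (S (Suc k) $ i - lam * w k $ i / (2 * beta)))"
    by (rule singular_values_eq)
  ultimately show "is_svd (X (Suc k)) (U (Suc k)) (singular_values (X (Suc k))) (V (Suc k))" by simp
qed

text \<open>
  The new iterate minimises the subproblem; this compares its value with that of the old iterate.
\<close>
lemma subproblem_decrease:
  "gradf (Y k) \<bullet> (X (Suc k) - X k) + beta / 2 * (norm (X (Suc k) - Y k))\<^sup>2 + beta / 2 * (step (Suc k))\<^sup>2
    + lam * (\<Sum>i\<in>UNIV. w k $ i * (sv (Suc k) i - sv k i)) \<le> beta / 2 * (norm (Y k - X k))\<^sup>2"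
proof -
  define c where "c = (\<chi> i. lam * w k $ i / (2 * beta))"
  have "(norm (X (Suc k) - target k))\<^sup>2 + 2 * (\<Sum>i\<in>UNIV. c $ i * sv (Suc k) i)
      \<le> (norm (X k - target k))\<^sup>2 + 2 * (\<Sum>i\<in>UNIV. c $ i * sv k i)"
    using soft_threshold_minimizes[OF dims svd_target[of k] threshold_mono[of k] refl, of "X k"]
    by (simp add: X_Suc[symmetric] sv_Suc c_def)
  then have "beta * ((norm (X (Suc k) - target k))\<^sup>2 - (norm (X k - target k))\<^sup>2)
      + beta * (2 * (\<Sum>i\<in>UNIV. c $ i * (sv (Suc k) i - sv k i))) \<le> 0"
    using beta unfolding distrib_left[symmetric] by (simp add: mult_le_0_iff right_diff_distrib sum_subtractf)
  moreover have "beta * (2 * (\<Sum>i\<in>UNIV. c $ i * (sv (Suc k) i - sv k i)))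
      = lam * (\<Sum>i\<in>UNIV. w k $ i * (sv (Suc k) i - sv k i))"
    using beta unfolding sum_distrib_left by (intro sum.cong) (auto simp: c_def)
  moreover define q where "q = (1 / 2) *\<^sub>R (Y k - X k) - (1 / (2 * beta)) *\<^sub>R gradf (Y k)"
  have "(1 / 2) *\<^sub>R (X k + Y k) = X k + (1 / 2) *\<^sub>R (Y k - X k)"
    by (simp add: vec_eq_iff field_simps)
  then have target: "target k = X k + q" by (simp add: target_def q_def)
  have "beta * ((norm (X (Suc k) - target k))\<^sup>2 - (norm (X k - target k))\<^sup>2)
      = gradf (Y k) \<bullet> (X (Suc k) - X k) + beta / 2 * (norm (X (Suc k) - Y k))\<^sup>2
        + beta / 2 * (norm (X (Suc k) - X k))\<^sup>2 - beta / 2 * (norm (Y k - X k))\<^sup>2"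
    using gradient_step_completion[OF beta(2) q_def, of "X (Suc k) - X k"]
    by (simp add: target algebra_simps)
  ultimately show ?thesis unfolding step_Suc by linarith
qed

text \<open>
  The weights are the slopes of the concave function \<open>x powr p\<close> at the smoothed singular values, so the
  weighted sum in the subproblem majorises the change of the powers; the smoothing parameters only decrease.
  For \<open>f\<close>, the quadratic upper bound at the extrapolated point costs at most \<open>beta / 2\<close> times a squared
  distance that the subproblem pays for.
\<close>
lemma smoothed_decrease:
  "smoothed (Suc k) \<le> smoothed k + (f (Y k) - f (X k) + gradf (Y k) \<bullet> (X k - Y k))
     + beta / 2 * (norm (Y k - X k))\<^sup>2 - beta / 2 * (step (Suc k))\<^sup>2"
proof -
  have "(\<Sum>i\<in>UNIV. (sv (Suc k) i + eps (Suc k) $ i) powr p)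
      \<le> (\<Sum>i\<in>UNIV. (sv k i + eps k $ i) powr p + w k $ i * (sv (Suc k) i - sv k i))"
  proof (rule sum_mono)
    fix i
    have "(sv (Suc k) i + eps (Suc k) $ i) powr p \<le> (sv (Suc k) i + eps k $ i) powr p"
      using p eps_Suc_le[of k i] sv_eps_pos[of "Suc k" i] by (intro powr_mono2) auto
    also have "\<dots> \<le> (sv k i + eps k $ i) powr p + w k $ i * (sv (Suc k) i - sv k i)"
      using powr_below_tangent[of "sv (Suc k) i + eps k $ i" "sv k i + eps k $ i" p]
        p sv_eps_pos[of k i] sv_nonneg[of "Suc k" i] eps_pos[of k i]
      by (simp add: w_def weights_def)
    finally show "(sv (Suc k) i + eps (Suc k) $ i) powr p
      \<le> (sv k i + eps k $ i) powr p + w k $ i * (sv (Suc k) i - sv k i)" .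
  qed
  then have "lam * (\<Sum>i\<in>UNIV. (sv (Suc k) i + eps (Suc k) $ i) powr p)
      \<le> lam * (\<Sum>i\<in>UNIV. (sv k i + eps k $ i) powr p) + lam * (\<Sum>i\<in>UNIV. w k $ i * (sv (Suc k) i - sv k i))"
    using lam by (simp add: sum.distrib flip: distrib_left)
  moreover have "f (X (Suc k)) \<le> f (Y k) + gradf (Y k) \<bullet> (X (Suc k) - Y k) + beta / 2 * (norm (X (Suc k) - Y k))\<^sup>2"
    using lipschitz_gradient_upper_bound[OF grad lipschitz, of "X (Suc k)" "Y k"]
      mult_right_mono[of "L / 2" "beta / 2" "(norm (X (Suc k) - Y k))\<^sup>2"] beta by simp
  moreover have "gradf (Y k) \<bullet> (X (Suc k) - Y k) = gradf (Y k) \<bullet> (X (Suc k) - X k) + gradf (Y k) \<bullet> (X k - Y k)"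
    by (simp add: inner_diff_right)
  ultimately show ?thesis
    using subproblem_decrease[of k] unfolding smoothed_def by linarith
qed

text \<open>
  The bracket in \<open>smoothed_decrease\<close> is nonpositive if \<open>f\<close> is convex; in general it is at most
  \<open>L / 2 * (norm (Y k - X k))\<^sup>2\<close>. The bounds on \<open>alpha_bar\<close> keep the resulting coefficient of
  \<open>(step k)\<^sup>2\<close> strictly below \<open>beta / 2\<close>.
\<close>
lemma merit_decrease:
  "\<exists>kappa. kappa < beta / 2 \<and> (\<forall>k. smoothed (Suc k) + beta / 2 * (step (Suc k))\<^sup>2 \<le> smoothed k + kappa * (step k)\<^sup>2)"
proof -
  have alpha_sq: "(alpha k)\<^sup>2 * (step k)\<^sup>2 \<le> alpha_bar\<^sup>2 * (step k)\<^sup>2" for k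
    using alpha[of k] by (intro mult_right_mono power_mono) auto
  show ?thesis
  proof (cases "convex_on UNIV f")
    case True
    have "alpha_bar\<^sup>2 < 1" using alpha_bar_cases True by (simp add: power_less_one_iff)
    moreover have "smoothed (Suc k) + beta / 2 * (step (Suc k))\<^sup>2 \<le> smoothed k + (beta / 2 * alpha_bar\<^sup>2) * (step k)\<^sup>2" for k
    proof -
      have "f (Y k) + gradf (Y k) \<bullet> (X k - Y k) \<le> f (X k)"
        by (rule convex_above_gradient_tangent[OF True grad])
      moreover have "beta / 2 * (norm (Y k - X k))\<^sup>2 \<le> beta / 2 * (alpha_bar\<^sup>2 * (step k)\<^sup>2)"
        unfolding norm_Y_diff power_mult_distrib using alpha_sq beta by (intro mult_left_mono) auto
      ultimately show ?thesis using smoothed_decrease[of k] by (simp only: mult.assoc)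
    qed
    ultimately show ?thesis using beta by (intro exI[of _ "beta / 2 * alpha_bar\<^sup>2"]) auto
  next
    case False
    have "alpha_bar\<^sup>2 * (beta + L) \<le> alpha_bar\<^sup>2 * (beta + 3 * L)"
      using L_nonneg by (intro mult_left_mono) auto
    then have "(beta + L) / 2 * alpha_bar\<^sup>2 < beta / 2"
      using alpha_bar_sq_nonconvex[OF False] by (simp add: mult.commute)
    moreover have "smoothed (Suc k) + beta / 2 * (step (Suc k))\<^sup>2 \<le> smoothed k + ((beta + L) / 2 * alpha_bar\<^sup>2) * (step k)\<^sup>2" for k
    proof -
      have "f (Y k) + gradf (Y k) \<bullet> (X k - Y k) - L / 2 * (norm (Y k - X k))\<^sup>2 \<le> f (X k)"
        using lipschitz_gradient_lower_bound[OF grad lipschitz, of "Y k" "X k"] by (simp add: norm_minus_commute)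
      moreover have "(beta + L) / 2 * (norm (Y k - X k))\<^sup>2 \<le> (beta + L) / 2 * (alpha_bar\<^sup>2 * (step k)\<^sup>2)"
        unfolding norm_Y_diff power_mult_distrib using alpha_sq beta L_nonneg by (intro mult_left_mono) auto
      ultimately show ?thesis
        using smoothed_decrease[of k] by (simp only: mult.assoc add_divide_distrib distrib_right)
    qed
    ultimately show ?thesis by (intro exI[of _ "(beta + L) / 2 * alpha_bar\<^sup>2"]) auto
  qed
qed

definition merit :: "nat \<Rightarrow> real" where
  "merit k = smoothed k + beta / 2 * (step k)\<^sup>2"

lemma merit_decrease_steps:
  obtains c where "0 < c" "\<And>k. merit (Suc k) \<le> merit k - c * (step k)\<^sup>2"
proof -
  obtain kappa where "kappa < beta / 2"
    "\<And>k. smoothed (Suc k) + beta / 2 * (step (Suc k))\<^sup>2 \<le> smoothed k + kappa * (step k)\<^sup>2"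
    using merit_decrease by blast
  then show ?thesis
    by (intro that[of "beta / 2 - kappa"]) (auto simp: merit_def algebra_simps)
qed

lemma merit_decseq: "decseq merit"
proof -
  obtain c where "0 < c" "\<And>k. merit (Suc k) \<le> merit k - c * (step k)\<^sup>2" using merit_decrease_steps by blast
  then show ?thesis
    unfolding decseq_Suc_iff by (smt (verit) mult_nonneg_nonneg zero_le_power2)
qed

lemma objective_le_merit: "objective f lam p (X k) \<le> merit k"
proof -
  have "(\<Sum>i\<in>UNIV. sv k i powr p) \<le> (\<Sum>i\<in>UNIV. (sv k i + eps k $ i) powr p)"
    using p eps_pos[of k] sv_nonneg[of k] by (intro sum_mono powr_mono2) (auto simp: less_imp_le)
  then have "lam * (\<Sum>i\<in>UNIV. sv k i powr p) \<le> lam * (\<Sum>i\<in>UNIV. (sv k i + eps k $ i) powr p)"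
    using lam by (intro mult_left_mono) auto
  moreover have "0 \<le> beta / 2 * (step k)\<^sup>2" using beta by simp
  ultimately show ?thesis by (simp add: objective_def merit_def smoothed_def)
qed

text \<open>
  The merit dominates the objective and decreases, so the iterates stay in one sublevel set.
\<close>
lemma bounded_iterates: obtains R where "0 < R" "\<And>k. norm (X k) \<le> R"
proof -
  have "\<forall>\<^sub>F Z in at_infinity. merit 0 < objective f lam p Z"
    using level_bounded by (simp add: filterlim_at_top_dense)
  then obtain R where R: "\<And>Z. R \<le> norm Z \<Longrightarrow> merit 0 < objective f lam p Z"
    by (auto simp: eventually_at_infinity)
  have "norm (X k) \<le> max R 1" for k
    using R[of "X k"] objective_le_merit[of k] decseqD[OF merit_decseq, of 0 k] by force
  then show ?thesis by (intro that[of "max R 1"]) auto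
qed

lemma bounded_range: "bounded (range X)"
  using bounded_iterates by (metis bounded_iff rangeE)

lemma continuous_f: "continuous_on UNIV f"
  using grad unfolding gderiv_def by (intro continuous_at_imp_continuous_on ballI) (rule has_derivative_continuous)

lemma continuous_objective: "continuous_on UNIV (objective f lam p)"
  unfolding objective_def
  using p singular_values_nonneg[OF dims]
  by (intro continuous_intros continuous_f continuous_on_powr' continuous_singular_value[OF dims]) auto

lemma merit_converges: "convergent merit"
proof -
  obtain R where R: "\<And>k. norm (X k) \<le> R" using bounded_iterates by blast
  have "compact (f ` cball 0 R)"
    using continuous_on_subset[OF continuous_f] by (intro compact_continuous_image) auto
  then obtain B where B: "\<And>Z. Z \<in> cball 0 R \<Longrightarrow> \<bar>f Z\<bar> \<le> B"
    using compact_imp_bounded by (fastforce simp: bounded_iff)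
  have "- B \<le> merit k" for k
  proof -
    have "- B \<le> f (X k)" using B[of "X k"] R[of k] by auto
    also have "\<dots> \<le> objective f lam p (X k)"
      using lam by (auto simp: objective_def intro!: mult_nonneg_nonneg sum_nonneg)
    finally show ?thesis using objective_le_merit[of k] by simp
  qed
  then show ?thesis using decseq_convergent[OF merit_decseq] by (metis convergentI)
qed

lemma step_tendsto_0: "step \<longlonglongrightarrow> 0"
proof -
  obtain c where c: "0 < c" "\<And>k. merit (Suc k) \<le> merit k - c * (step k)\<^sup>2" using merit_decrease_steps by blast
  obtain l where l: "merit \<longlonglongrightarrow> l" using merit_converges by (auto simp: convergent_def)
  have "(\<lambda>k. (merit k - merit (Suc k)) / c) \<longlonglongrightarrow> (l - l) / c"
    by (intro tendsto_intros l LIMSEQ_Suc) (use c in auto)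
  then have "(\<lambda>k. (merit k - merit (Suc k)) / c) \<longlonglongrightarrow> 0" by simp
  moreover have "(step k)\<^sup>2 \<le> (merit k - merit (Suc k)) / c" for k
    using c(1) c(2)[of k] by (simp add: pos_le_divide_eq mult.commute)
  ultimately have "(\<lambda>k. (step k)\<^sup>2) \<longlonglongrightarrow> 0"
    by (intro Lim_null_comparison[of "\<lambda>k. (step k)\<^sup>2"]) auto
  from tendsto_real_sqrt[OF this] show ?thesis by (simp add: step_nonneg)
qed

section \<open>Convergence of the objective values\<close>
lemma eps_converges: "convergent (\<lambda>k. eps k $ i)"
proof -
  have "decseq (\<lambda>k. eps k $ i)" by (simp add: decseq_Suc_iff eps_Suc_le)
  then show ?thesis
    using decseq_convergent[of "\<lambda>k. eps k $ i" 0] eps_pos by (metis convergentI less_imp_le)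
qed

text \<open>
  Each visit of an index to the positive ones damps its smoothing value by \<open>mu\<close>, and the values never grow.
\<close>
lemma eps_vanishes_or_index_dies:
  "(\<lambda>k. eps k $ i) \<longlonglongrightarrow> 0 \<or> (\<forall>\<^sub>F k in sequentially. i \<notin> pos_idx (X k))"
proof (rule disjCI)
  assume "\<not> (\<forall>\<^sub>F k in sequentially. i \<notin> pos_idx (X k))"
  then have "\<not> (\<forall>\<^sub>F k in sequentially. i \<notin> pos_idx (X (Suc k)))"
    unfolding eventually_sequentially_Suc[of "\<lambda>k. i \<notin> pos_idx (X k)"] .
  then have "infinite {k. i \<in> pos_idx (X (Suc k))}"
    by (auto simp: eventually_cofinite simp flip: cofinite_eq_sequentially)
  then obtain r where r: "strict_mono r" "\<And>n::nat. i \<in> pos_idx (X (Suc (r n)))"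
    using infinite_enumerate by blast
  obtain l where l: "(\<lambda>k. eps k $ i) \<longlonglongrightarrow> l" using eps_converges by (auto simp: convergent_def)
  have "(\<lambda>n. eps (Suc (r n)) $ i) \<longlonglongrightarrow> l"
    using LIMSEQ_subseq_LIMSEQ[OF LIMSEQ_Suc[OF l] r(1)] by (simp add: o_def)
  moreover have "(\<lambda>n. mu * eps (r n) $ i) \<longlonglongrightarrow> mu * l"
    using LIMSEQ_subseq_LIMSEQ[OF l r(1)] by (intro tendsto_mult_left) (simp add: o_def)
  ultimately have "l \<le> mu * l"
    by (rule LIMSEQ_le) (use eps_shrinks r(2) in blast)
  moreover have "0 \<le> l" by (rule LIMSEQ_le_const[OF l]) (use eps_pos in \<open>auto intro: less_imp_le\<close>)
  ultimately have "l = 0" using mult_strict_right_mono[OF mu(2), of l] by linarith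
  then show "(\<lambda>k. eps k $ i) \<longlonglongrightarrow> 0" using l by simp
qed

text \<open>
  The gap tends to 0 where the smoothing vanishes. Otherwise the singular value is eventually 0, and
  the gap is a power of a convergent smoothing value, whose limit need not be 0.
\<close>
lemma smoothing_gap_converges: "convergent (\<lambda>k. (sv k i + eps k $ i) powr p - sv k i powr p)"
  using eps_vanishes_or_index_dies[of i]
proof
  assume eps0: "(\<lambda>k. eps k $ i) \<longlonglongrightarrow> 0"
  have "(\<lambda>k. (eps k $ i) powr p) \<longlonglongrightarrow> 0 powr p"
    using eps0 p by (intro tendsto_powr') (auto simp: less_imp_le[OF eps_pos])
  then have "(\<lambda>k. (eps k $ i) powr p) \<longlonglongrightarrow> 0" by simp
  moreover have "\<bar>(sv k i + eps k $ i) powr p - sv k i powr p\<bar> \<le> (eps k $ i) powr p" for k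
    using powr_subadditive[of "sv k i" "eps k $ i" p] powr_mono2[of p "sv k i" "sv k i + eps k $ i"]
      p eps_pos[of k i] sv_nonneg[of k i] by simp
  then have "\<forall>\<^sub>F k in sequentially. norm ((sv k i + eps k $ i) powr p - sv k i powr p) \<le> (eps k $ i) powr p"
    by simp
  ultimately have "(\<lambda>k. (sv k i + eps k $ i) powr p - sv k i powr p) \<longlonglongrightarrow> 0"
    by (rule Lim_null_comparison[rotated])
  then show ?thesis by (rule convergentI)
next
  assume dead: "\<forall>\<^sub>F k in sequentially. i \<notin> pos_idx (X k)"
  obtain l where l: "(\<lambda>k. eps k $ i) \<longlonglongrightarrow> l" using eps_converges by (auto simp: convergent_def)
  have "(\<lambda>k. (eps k $ i) powr p) \<longlonglongrightarrow> l powr p"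
    using l p by (intro tendsto_powr') (auto simp: less_imp_le[OF eps_pos])
  moreover have "\<forall>\<^sub>F k in sequentially. (eps k $ i) powr p = (sv k i + eps k $ i) powr p - sv k i powr p"
    using dead
  proof eventually_elim
    case (elim k)
    then have "sv k i = 0" using sv_nonneg[of k i] by (simp add: pos_idx_def)
    then show ?case by simp
  qed
  ultimately have "(\<lambda>k. (sv k i + eps k $ i) powr p - sv k i powr p) \<longlonglongrightarrow> l powr p"
    by (rule Lim_transform_eventually)
  then show ?thesis by (rule convergentI)
qed

lemma objective_converges: "convergent (\<lambda>k. objective f lam p (X k))"
proof -
  have "objective f lam p (X k) = merit k - beta / 2 * (step k)\<^sup>2
      - lam * (\<Sum>i\<in>UNIV. (sv k i + eps k $ i) powr p - sv k i powr p)" for k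
    by (simp add: objective_def merit_def smoothed_def sum_subtractf algebra_simps)
  moreover have "convergent (\<lambda>k. beta / 2 * (step k)\<^sup>2)"
    using tendsto_mult_left[OF tendsto_power[OF step_tendsto_0, of 2]] by (rule convergentI)
  moreover have "convergent (\<lambda>k. lam * (\<Sum>i\<in>UNIV. (sv k i + eps k $ i) powr p - sv k i powr p))"
    by (rule convergent_mult[OF convergent_const convergent_sum[OF smoothing_gap_converges]])
  ultimately show ?thesis
    using merit_converges by (simp only:) (intro convergent_diff)
qed

lemma objective_constant_on_cluster_points: "objective f lam p constant_on cluster_points X"
proof -
  obtain l where l: "(\<lambda>k. objective f lam p (X k)) \<longlonglongrightarrow> l"
    using objective_converges by (auto simp: convergent_def)
  have "objective f lam p Z = l" if Z: "Z \<in> cluster_points X" for Z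
  proof -
    obtain r where r: "strict_mono r" "(X \<circ> r) \<longlonglongrightarrow> Z"
      using Z by (auto simp: cluster_points_def)
    have "isCont (objective f lam p) Z"
      using continuous_objective by (simp add: continuous_on_eq_continuous_at)
    then have "(\<lambda>k. objective f lam p ((X \<circ> r) k)) \<longlonglongrightarrow> objective f lam p Z"
      using r(2) by (rule isCont_tendsto_compose)
    moreover have "(\<lambda>k. objective f lam p ((X \<circ> r) k)) \<longlonglongrightarrow> l"
      using LIMSEQ_subseq_LIMSEQ[OF l r(1)] by (simp add: o_def)
    ultimately show ?thesis by (rule LIMSEQ_unique)
  qed
  then show ?thesis unfolding constant_on_def by blast
qed

section \<open>The residual and criticality of cluster points\<close>
lemma bounded_target: obtains B where "0 < B" "\<And>k. norm (target k) \<le> B"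
proof -
  obtain R where R: "0 < R" "\<And>k. norm (X k) \<le> R" using bounded_iterates by blast
  have Y: "norm (Y k) \<le> 3 * R" for k
  proof -
    have "norm (Y k) \<le> norm (X k) + norm (Y k - X k)" using norm_triangle_ineq[of "X k" "Y k - X k"] by simp
    moreover have "step k \<le> norm (X k) + norm (X (k - 1))" unfolding step_def by (rule norm_triangle_ineq4)
    ultimately show ?thesis using norm_Y_diff_le[of k] R(2)[of k] R(2)[of "k - 1"] by linarith
  qed
  have gradY: "norm (gradf (Y k)) \<le> norm (gradf 0) + L * (3 * R)" for k
  proof -
    have "norm (gradf (Y k) - gradf 0) \<le> L * norm (Y k)"
      using lipschitz_onD[OF lipschitz, of "Y k" 0] by (simp add: dist_norm)
    also have "\<dots> \<le> L * (3 * R)" using Y L_nonneg by (intro mult_left_mono)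
    finally show ?thesis using norm_triangle_ineq[of "gradf 0" "gradf (Y k) - gradf 0"] by simp
  qed
  have "norm (target k) \<le> 2 * R + (1 / (2 * beta)) * (norm (gradf 0) + L * (3 * R))" for k
  proof -
    have "norm (target k) \<le> norm ((1 / 2) *\<^sub>R (X k + Y k)) + norm ((1 / (2 * beta)) *\<^sub>R gradf (Y k))"
      unfolding target_def by (rule norm_triangle_ineq4)
    moreover have "norm ((1 / 2) *\<^sub>R (X k + Y k)) \<le> 2 * R"
      using norm_triangle_ineq[of "X k" "Y k"] R(2)[of k] Y[of k] by simp
    moreover have "norm ((1 / (2 * beta)) *\<^sub>R gradf (Y k)) \<le> (1 / (2 * beta)) * (norm (gradf 0) + L * (3 * R))"
      using gradY[of k] beta unfolding norm_scaleR by (intro mult_mono) auto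
    ultimately show ?thesis by linarith
  qed
  moreover have "0 < 2 * R + (1 / (2 * beta)) * (norm (gradf 0) + L * (3 * R))"
    using R(1) beta L_nonneg by (intro add_pos_nonneg mult_nonneg_nonneg add_nonneg_nonneg) auto
  ultimately show ?thesis by (rule that[rotated])
qed

text \<open>
  An index stays positive only if its singular value exceeds the threshold. The singular values that are
  thresholded are bounded, so the weight is bounded as well; this keeps the smoothed singular value away from 0,
  because weights blow up at 0.
\<close>
lemma surviving_value_bounded_below:
  obtains d where "0 < d" "\<And>k i. i \<in> pos_idx (X (Suc k)) \<Longrightarrow> d \<le> sv k i + eps k $ i"
proof -
  obtain B where B: "0 < B" "\<And>k. norm (target k) \<le> B" using bounded_target by blast
  \<comment> \<open>\<open>W\<close> bounds the weights of the positive indices, and \<open>d\<close> is the smoothed singular value of weight \<open>W\<close>.\<close>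
  define W where "W = 2 * beta * B / lam"
  define d where "d = (W / p) powr (1 / (p - 1))"
  have W: "0 < W" using B beta lam by (simp add: W_def)
  have d: "0 < d" "d powr (p - 1) = W / p" using W p by (simp_all add: d_def powr_powr)
  have "d \<le> sv k i + eps k $ i" if "i \<in> pos_idx (X (Suc k))" for k i
  proof (rule ccontr)
    assume "\<not> ?thesis"
    then have "d powr (p - 1) < (sv k i + eps k $ i) powr (p - 1)"
      using sv_eps_pos[of k i] p by (intro powr_less_mono2_neg) auto
    then have "W < w k $ i" using d(2) p by (simp add: w_def weights_def pos_divide_less_eq mult.commute)
    then have "2 * beta * B < lam * w k $ i" using lam by (simp add: W_def pos_divide_less_eq mult.commute)
    moreover have "lam * w k $ i / (2 * beta) < S (Suc k) $ i"
      using that by (simp add: pos_idx_def sv_Suc)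
    then have "lam * w k $ i < 2 * beta * S (Suc k) $ i" using beta by (simp add: pos_divide_less_eq mult.commute)
    moreover have "S (Suc k) $ i \<le> B"
      using component_le_norm_cart[of "S (Suc k)" i] svd_norm[OF svd_target[of k]] B(2)[of k] by simp
    then have "2 * beta * S (Suc k) $ i \<le> 2 * beta * B" using beta by (intro mult_left_mono) auto
    ultimately show False by linarith
  qed
  with d(1) show ?thesis by (rule that)
qed

text \<open>
  The change of the residual that is caused by evaluating the weights at the new singular values without
  smoothing instead of at the old smoothed ones.
\<close>
definition weight_error :: "nat \<Rightarrow> 'm \<Rightarrow> real" where
  "weight_error k i = (if i \<in> pos_idx (X (Suc k)) then p * sv (Suc k) i powr (p - 1) - w k $ i else 0)"

text \<open>
  On indices with vanishing smoothing that remain positive, old and new singular values stay away from 0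
  by \<open>surviving_value_bounded_below\<close>, and there the weight is a Lipschitz function of the singular value.
\<close>
lemma weight_error_tendsto_0: "(\<lambda>k. weight_error k i) \<longlonglongrightarrow> 0"
  using eps_vanishes_or_index_dies[of i]
proof
  assume "\<forall>\<^sub>F k in sequentially. i \<notin> pos_idx (X k)"
  then have "\<forall>\<^sub>F k in sequentially. i \<notin> pos_idx (X (Suc k))"
    unfolding eventually_sequentially_Suc[of "\<lambda>k. i \<notin> pos_idx (X k)"] .
  then have "\<forall>\<^sub>F k in sequentially. weight_error k i = 0"
    by eventually_elim (simp add: weight_error_def)
  then show ?thesis by (rule tendsto_eventually)
next
  assume eps0: "(\<lambda>k. eps k $ i) \<longlonglongrightarrow> 0"
  obtain d where d: "0 < d" "\<And>k i. i \<in> pos_idx (X (Suc k)) \<Longrightarrow> d \<le> sv k i + eps k $ i"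
    using surviving_value_bounded_below by blast
  define K where "K = p * (\<bar>p - 1\<bar> * (d / 2) powr (p - 1 - 1))"
  have "\<forall>\<^sub>F k in sequentially. eps k $ i < d / 4"
    using order_tendstoD(2)[OF eps0, of "d / 4"] d(1) by simp
  moreover have "\<forall>\<^sub>F k in sequentially. step (Suc k) < d / 4"
    using order_tendstoD(2)[OF LIMSEQ_Suc[OF step_tendsto_0], of "d / 4"] d(1) by simp
  ultimately have "\<forall>\<^sub>F k in sequentially. norm (weight_error k i) \<le> K * (step (Suc k) + eps k $ i)"
  proof eventually_elim
    case (elim k)
    have K: "0 \<le> K" using p by (simp add: K_def)
    show ?case
    proof (cases "i \<in> pos_idx (X (Suc k))")
      case True
      have diff: "\<bar>sv (Suc k) i - sv k i\<bar> \<le> step (Suc k)"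
        unfolding step_Suc by (rule singular_values_diff_le[OF dims])
      have "\<bar>sv (Suc k) i powr (p - 1) - (sv k i + eps k $ i) powr (p - 1)\<bar>
          \<le> \<bar>p - 1\<bar> * (d / 2) powr (p - 1 - 1) * \<bar>sv (Suc k) i - (sv k i + eps k $ i)\<bar>"
        using d(1) d(2)[OF True] elim diff p by (intro powr_lipschitz_away_from_zero) auto
      then have "p * \<bar>sv (Suc k) i powr (p - 1) - (sv k i + eps k $ i) powr (p - 1)\<bar>
          \<le> p * (\<bar>p - 1\<bar> * (d / 2) powr (p - 1 - 1) * \<bar>sv (Suc k) i - (sv k i + eps k $ i)\<bar>)"
        using p by (intro mult_left_mono) auto
      also have "\<dots> = K * \<bar>sv (Suc k) i - (sv k i + eps k $ i)\<bar>" by (simp add: K_def)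
      also have "\<dots> \<le> K * (step (Suc k) + eps k $ i)"
        using diff eps_pos[of k i] K by (intro mult_left_mono) auto
      finally show ?thesis
        using True p by (simp add: weight_error_def w_def weights_def abs_mult flip: right_diff_distrib)
    next
      case False
      then show ?thesis
        using K step_nonneg[of "Suc k"] eps_pos[of k i] by (simp add: weight_error_def)
    qed
  qed
  moreover have "(\<lambda>k. K * (step (Suc k) + eps k $ i)) \<longlonglongrightarrow> K * (0 + 0)"
    by (intro tendsto_intros LIMSEQ_Suc step_tendsto_0 eps0)
  then have "(\<lambda>k. K * (step (Suc k) + eps k $ i)) \<longlonglongrightarrow> 0" by simp
  ultimately show ?thesis by (rule Lim_null_comparison)
qed

definition xi :: "nat \<Rightarrow> 'm rvec" where
  "xi k = xi_vector gradf lam beta (X k) (Y k) (X (Suc k)) (w k) (U (Suc k)) (V (Suc k))"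

lemma
  shows xi_active: "i \<in> pos_idx (X (Suc k)) \<Longrightarrow> xi k $ i = 1"
    and xi_optimality: "0 = gradf (Y k) + beta *\<^sub>R (X (Suc k) - Y k) + beta *\<^sub>R (X (Suc k) - X k)
      + lam *\<^sub>R (U (Suc k) ** diag (w k * xi k) ** transpose (V (Suc k)))"
  using xi_vector_optimality[of beta lam "w k" "X k" "Y k" gradf "U (Suc k)" "S (Suc k)" "V (Suc k)" "X (Suc k)",
      OF beta(2) lam w_pos w_mono svd_target[unfolded target_def] X_Suc]
  unfolding xi_def by blast+

lemma residual_eq:
  "residual gradf lam p beta alpha X eps U V k
    = gradf (X (Suc k)) + lam *\<^sub>R (U (Suc k) ** diag (limit_weights p (X (Suc k)) (w k) * xi k) ** transpose (V (Suc k)))"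
  by (simp add: residual_def Let_def xi_def w_def Y_def)

text \<open>
  Subtract the first order condition of the subproblem, which holds exactly, from the residual.
\<close>
lemma norm_residual_le:
  "norm (residual gradf lam p beta alpha X eps U V k)
    \<le> (L + beta) * (step (Suc k) + step k) + beta * step (Suc k) + lam * norm (\<chi> i. weight_error k i)"
proof -
  have error: "limit_weights p (X (Suc k)) (w k) * xi k = w k * xi k + (\<chi> i. weight_error k i)"
    by (simp add: vec_eq_iff limit_weights_def weight_error_def xi_active)
  have norm4: "norm (a - b - c + d) \<le> norm a + norm b + norm c + norm d" for a b c d :: "('m, 'n) rmat"
    using norm_triangle_ineq[of "a - b - c" d] norm_triangle_ineq4[of "a - b" c] norm_triangle_ineq4[of a b]
    by linarith
  have "residual gradf lam p beta alpha X eps U V k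
      = (gradf (X (Suc k)) - gradf (Y k)) - beta *\<^sub>R (X (Suc k) - Y k) - beta *\<^sub>R (X (Suc k) - X k)
        + lam *\<^sub>R (U (Suc k) ** diag (\<chi> i. weight_error k i) ** transpose (V (Suc k)))"
    using xi_optimality[of k] unfolding residual_eq error diag_sandwich_linear scaleR_add_right
    by (simp add: algebra_simps eq_neg_iff_add_eq_0)
  also have "norm \<dots> \<le> norm (gradf (X (Suc k)) - gradf (Y k)) + norm (beta *\<^sub>R (X (Suc k) - Y k))
      + norm (beta *\<^sub>R (X (Suc k) - X k)) + norm (lam *\<^sub>R (U (Suc k) ** diag (\<chi> i. weight_error k i) ** transpose (V (Suc k))))"
    by (rule norm4)
  also have "\<dots> \<le> L * norm (X (Suc k) - Y k) + beta * norm (X (Suc k) - Y k) + beta * step (Suc k) + lam * norm (\<chi> i. weight_error k i)"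
    using lipschitz_onD[OF lipschitz, of "X (Suc k)" "Y k"] beta lam
      norm_diag_sandwich[OF is_svdD(1,2)[OF svd_target[of k]]]
    by (simp add: dist_norm step_Suc)
  also have "\<dots> = (L + beta) * norm (X (Suc k) - Y k) + beta * step (Suc k) + lam * norm (\<chi> i. weight_error k i)"
    by (simp add: distrib_right)
  also have "norm (X (Suc k) - Y k) \<le> step (Suc k) + step k"
    using norm_triangle_ineq4[of "X (Suc k) - X k" "Y k - X k"] norm_Y_diff_le[of k] by (simp add: step_Suc)
  finally show ?thesis using L_nonneg beta by (simp add: mult_left_mono)
qed

lemma residual_tendsto_0: "(\<lambda>k. residual gradf lam p beta alpha X eps U V k) \<longlonglongrightarrow> 0"
proof (rule Lim_null_comparison)
  show "\<forall>\<^sub>F k in sequentially. norm (residual gradf lam p beta alpha X eps U V k)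
    \<le> (L + beta) * (step (Suc k) + step k) + beta * step (Suc k) + lam * norm (\<chi> i. weight_error k i)"
    using norm_residual_le by simp
  have "(\<lambda>k. (\<chi> i. weight_error k i)) \<longlonglongrightarrow> (\<chi> i. 0)"
    by (intro tendsto_vec_lambda weight_error_tendsto_0)
  moreover have "(\<chi> i. 0) = (0 :: 'm rvec)" by (simp add: vec_eq_iff)
  ultimately have errors: "(\<lambda>k. norm (\<chi> i. weight_error k i)) \<longlonglongrightarrow> 0"
    using tendsto_norm_zero by metis
  have step': "(\<lambda>k. step (Suc k)) \<longlonglongrightarrow> 0" by (rule LIMSEQ_Suc[OF step_tendsto_0])
  show "(\<lambda>k. (L + beta) * (step (Suc k) + step k) + beta * step (Suc k) + lam * norm (\<chi> i. weight_error k i)) \<longlonglongrightarrow> 0"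
    using tendsto_add[OF tendsto_add[OF tendsto_mult_left[OF tendsto_add[OF step' step_tendsto_0], of "L + beta"]
          tendsto_mult_left[OF step', of beta]] tendsto_mult_left[OF errors, of lam]]
    by simp
qed

text \<open>
  On the positive indices, \<open>limit_weights\<close> carries the unsmoothed weights and \<open>xi\<close> is 1, so the
  coefficients there are the derivatives of the powers; on the zero indices a subgradient may have any.
\<close>
lemma residual_frechet:
  "residual gradf lam p beta alpha X eps U V k \<in> frechet_subdifferential (objective f lam p) (X (Suc k))"
  unfolding residual_eq
proof (rule frechet_subdifferential_objective[OF dims p lam grad svd_X_Suc])
  fix i assume "0 < sv (Suc k) i"
  then have "i \<in> pos_idx (X (Suc k))" by (simp add: pos_idx_def)
  then show "(limit_weights p (X (Suc k)) (w k) * xi k) $ i = p * sv (Suc k) i powr (p - 1)"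
    by (simp add: limit_weights_def xi_active)
qed

text \<open>
  The residuals are Frechet subgradients at the iterates, and along the subsequence they tend to 0.
\<close>
lemma cluster_point_critical:
  assumes "Z \<in> cluster_points X"
  shows "0 \<in> limiting_subdifferential (objective f lam p) Z"
proof -
  obtain r where r: "strict_mono r" "(X \<circ> r) \<longlonglongrightarrow> Z" using assms by (auto simp: cluster_points_def)
  \<comment> \<open>\<open>residual ... k\<close> belongs to iterate \<open>k + 1\<close>, so index 0 of the subsequence is skipped.\<close>
  define q where "q j = r (Suc j) - 1" for j
  have "strict_mono q"
    unfolding strict_mono_Suc_iff q_def
  proof
    fix j show "r (Suc j) - 1 < r (Suc (Suc j)) - 1"
      using strict_monoD[OF r(1), of "Suc j" "Suc (Suc j)"] strict_monoD[OF r(1), of 0 "Suc j"] by simp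
  qed
  have q: "Suc (q j) = r (Suc j)" for j
    using strict_monoD[OF r(1), of 0 "Suc j"] by (simp add: q_def)
  have Xq: "(\<lambda>j. X (Suc (q j))) \<longlonglongrightarrow> Z"
    using LIMSEQ_Suc[OF r(2)] by (simp add: q o_def)
  have "isCont (objective f lam p) Z"
    using continuous_objective by (simp add: continuous_on_eq_continuous_at)
  then have "(\<lambda>j. objective f lam p (X (Suc (q j)))) \<longlonglongrightarrow> objective f lam p Z"
    using Xq by (rule isCont_tendsto_compose)
  moreover have "(\<lambda>j. residual gradf lam p beta alpha X eps U V (q j)) \<longlonglongrightarrow> 0"
    using LIMSEQ_subseq_LIMSEQ[OF residual_tendsto_0 \<open>strict_mono q\<close>] by (simp add: o_def)
  ultimately show ?thesis
    unfolding limiting_subdifferential_def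
    by (intro CollectI exI[of _ "\<lambda>j. X (Suc (q j))"]
        exI[of _ "\<lambda>j. residual gradf lam p beta alpha X eps U V (q j)"] conjI allI Xq residual_frechet)
qed

end

theorem theorem3p7:
  fixes f :: "('m::{finite,linorder}, 'n::finite) rmat \<Rightarrow> real"
    and gradf :: "('m, 'n) rmat \<Rightarrow> ('m, 'n) rmat"
    and L lam p beta mu alpha_bar :: real
    and alpha :: "nat \<Rightarrow> real"
    and X :: "nat \<Rightarrow> ('m, 'n) rmat"
    and eps S :: "nat \<Rightarrow> 'm rvec"
    and U :: "nat \<Rightarrow> ('m, 'm) rmat"
    and V :: "nat \<Rightarrow> ('n, 'm) rmat"
  assumes dims: "CARD('m) \<le> CARD('n)"
    and p: "0 < p" "p < 1"
    and lam: "lam > 0"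
    and grad: "\<And>Z. GDERIV f Z :> gradf Z"
    and C2: "\<exists>hess :: ('m, 'n) rmat \<Rightarrow> ('m, 'n) rmat \<Rightarrow>\<^sub>L ('m, 'n) rmat.
               (\<forall>Z. (gradf has_derivative blinfun_apply (hess Z)) (at Z)) \<and> continuous_on UNIV hess"
    and lipschitz: "L-lipschitz_on UNIV gradf"
    and level_bounded: "filterlim (objective f lam p) at_top at_infinity"
    and algorithm: "EIRNRI f gradf L lam p beta mu alpha_bar alpha X eps U S V"
  shows "(cluster_points X \<noteq> {} \<and> compact (cluster_points X) \<and> connected (cluster_points X)) \<and>
         (convergent (\<lambda>k. objective f lam p (X k)) \<and>
          objective f lam p constant_on cluster_points X) \<and>
         ((\<lambda>k. norm (residual gradf lam p beta alpha X eps U V k)) \<longlonglongrightarrow> 0 \<and>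
          (\<forall>Xstar\<in>cluster_points X. 0 \<in> limiting_subdifferential (objective f lam p) Xstar))"
proof -
  interpret eirnri f gradf L lam p beta mu alpha_bar alpha X eps S U V
    using dims p lam grad lipschitz level_bounded algorithm by unfold_locales
  have "(\<lambda>k. dist (X (Suc k)) (X k)) \<longlonglongrightarrow> 0"
    using LIMSEQ_Suc[OF step_tendsto_0] by (simp add: step_Suc dist_norm)
  then show ?thesis
    using cluster_points_nonempty[OF bounded_range] compact_cluster_points[OF bounded_range]
      connected_cluster_points[OF bounded_range] objective_converges objective_constant_on_cluster_points
      tendsto_norm_zero[OF residual_tendsto_0] cluster_point_critical
    by blast
qed

end
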